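(* Let $n=2h$, $K\in\mathbb{TM}_n$, let $(\alpha,\beta)$ be a bistellar pair of type $h$ in $K$, and let $L=\mathbf{bm}_\alpha K$. The bistellar seed mutation $\Phi_\alpha:\Sigma_K\to\Sigma_L$ is invertible, and its inverse is the bistellar seed mutation $\Phi_\beta:\Sigma_L\to\Sigma_K$.
   Context: **Triangulated manifolds.** $\mathbb{TM}_n$ is the set of closed oriented triangulated manifolds of dimension $n>1$, i.e. finite abstract simplicial complexes on a vertex set $[m]=\{1,\dots,m\}$ whose geometric realization is a closed oriented topological $n$-manifold. The $n$-simplices are oriented so that their sum is a cycle; simplices of dimension less than $n$ carry the canonical orientation (increasing order of vertices); simplices of equal dimension are compared by the lexicographic order $<$ of their increasingly listed vertices. $\mathcal F_i^K$ is the set of $i$-simplices of $K$, and $\mathcal F(K)=\mathcal F_{n-1}^K$ (for a complex of dimension $n$). **Exchange matrix.** For an oriented simplex, $\partial^{(k)}(a_0,\dots,a_n)=\sum_{0\le i_1<\dots<i_k\le n}(-1)^{i_1+\dots+i_k}(\dots,\widehat{a_{i_1}},\dots,\widehat{a_{i_k}},\dots)$, and $\partial^{(k)}(-F)=-\partial^{(k)}F$. For an oriented $n$-simplex $F$ and $(n-1)$-faces $f<g$ of $F$ let $c_{fg}=\pm1$ be the coefficient in $\partial^{(n-1)}F$ of the canonically oriented edge $(f\cup g)\setminus(f\cap g)$. Set $b^F_{fg}=c_{fg}$, $b^F_{gf}=-c_{fg}$, and $b^F_{fg}=0$ if $f=g$ or $f,g$ are not both faces of $F$. Then $B(K)=(b^K_{fg})_{f,g\in\mathcal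 F(K)}$ with $b^K_{fg}=\sum_{F\in\mathcal F_n^K}b^F_{fg}$. **Bistellar move.** $\alpha\in K$, $\mathrm{Link}_K\alpha=\partial\beta$, $\beta\notin K$, $\dim\alpha=\dim\beta=h$; $L=\mathbf{bm}_\alpha K=(K\setminus(\alpha*\partial\beta))\cup(\partial\alpha*\beta)$, and $\mathbf{bm}_\beta L=K$. Put $\Lambda_\alpha=\alpha*\partial\beta$, $\Lambda_\beta=\partial\alpha*\beta$, $\mathcal D_\alpha=\mathcal F(\Lambda_\alpha)\setminus\mathcal F(\Lambda_\beta)$, $\mathcal D_\beta=\mathcal F(\Lambda_\beta)\setminus\mathcal F(\Lambda_\alpha)$. Standing normalization: the vertices of $\alpha\cup\beta$ are labelled so that $\alpha=(1,\dots,h+1)$, $\beta=(h+2,\dots,n+2)$, and $(1,\dots,n+1)$ is a positively oriented $n$-simplex of $K$. $n$-simplices of $L$ lying in $K$ keep their orientation, and the new ones are oriented as $(-1)^i(1,\dots,\widehat{i+1},\dots,n+2)$, $0\le i\le h$. Let $\sigma$ be the involution $i\mapsto n+3-i$ of $[n+2]$; it exchanges $\mathcal F(\Lambda_\alpha)$ with $\mathcal F(\Lambda_\beta)$ and $\mathcal D_\alpha$ with $\mathcal D_\beta$, and preserves $\mathcal F(\Lambda_\alpha)\setminus\mathcal D_\alpha=\mathcal F(\Lambda_\beta)\setminus\mathcal D_\beta$. **Seeds.** $(\mathbb P,\oplus,\cdot)$ is a semifield, $\mathbb{ZP}$ the integral group ring of $(\mathbb P,\cdot)$. $\mathcal X(K)=\{x_f\mid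 f\in\mathcal F(K)\}$ are independent variables. A seed is $\Sigma_K=(\mathcal X(K),\mathbf p_K,B(K))$ with $\mathbf p_K=(p^\pm_{K,x})_{x\in\mathcal X(K)}$ in $\mathbb P$ satisfying $p^+_{K,x}\oplus p^-_{K,x}=1$. Put $u^K_f=p^+_{K,x_f}/p^-_{K,x_f}$, $[b]_+=\max\{b,0\}$ and $\pi^K_{\alpha,f}=\prod_{g\in\mathcal D_\alpha}(p^+_{K,x_g})^{[b^K_{gf}]_+}(p^-_{K,x_g})^{-[-b^K_{gf}]_+}$. **Bistellar seed mutation $\Phi_\alpha:\Sigma_K\to\Sigma_L$.** (1) On clusters: the bijection $\varphi_\alpha^K:\mathcal X(K)\to\mathcal X(L)$, $x_f\mapsto x_{\sigma(f)}$ if $f\in\mathcal F(\Lambda_\alpha)$, $x_f\mapsto x_f$ otherwise, together with the exchange relations, for $f\in\mathcal D_\alpha$, $x_fx_{\sigma(f)}=M^+_{K,\alpha,f}+M^-_{K,\alpha,f}$, where $$M^{\pm}_{K,\alpha,f}=\frac{p^{\pm}_{K,x_f}}{D^K_{\alpha,f}}\operatorname{lcm}\Big(\prod_{g}x_g^{[\pm b^K_{fg}]_+},\ \prod_{g}x_{\sigma(g)}^{[\pm b^K_{fg}]_+}\Big),\qquad D^K_{\alpha,f}=\prod_{g:\ b^K_{fg}>0,\ b^K_{f\sigma(g)}<0}x_g^{b^K_{fg}}x_{\sigma(g)}^{b^K_{fg}},$$ all products over $g\in\mathcal F(\Lambda_\alpha)\setminus\mathcal D_\alpha$. (2) On coefficients: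 $\mathbf p_L$ is the tuple with $p^+_{L,x_f}\oplus p^-_{L,x_f}=1$ and, for $u^L_f=p^+_{L,x_f}/p^-_{L,x_f}$: $u^L_f=(u^K_{\sigma(f)})^{-1}$ if $f\in\mathcal D_\beta$; $u^L_f=\pi^K_{\alpha,\sigma(f)}u^K_{\sigma(f)}$ if $f\in\mathcal F(\Lambda_\beta)\setminus\mathcal D_\beta$; $u^L_f=u^K_f$ otherwise. (3) On matrices: $B(K)\mapsto\mu_\alpha(B(K))=B(L)$, where $\mu_\alpha(B(K))_{fg}=-b^K_{\sigma(f)\sigma(g)}$ if $f,g\in\mathcal F(\Lambda_\beta)$ and $b^K_{fg}$ otherwise (read as $0$ if $f$ or $g\notin\mathcal F(K)$). $\Phi_\beta:\Sigma_L\to\Sigma_K$ is defined in the same way with the roles of $(K,\alpha)$ and $(L,\beta)$ exchanged and the same $\sigma$. *)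

theory Defs
  imports "HOL-Analysis.Analysis" "HOL-Library.Multiset"
begin

section \<open>Simplicial complexes and triangulated manifolds\<close>

text \<open>A complex is a set of finite vertex sets containing the empty simplex, so that
  joins and links need no case distinction.  An \<open>i\<close>-simplex has \<open>i + 1\<close> vertices.\<close>

definition simplicial_complex :: "nat set set \<Rightarrow> bool" where
  "simplicial_complex K \<longleftrightarrow>
     {} \<in> K \<and> (\<forall>s\<in>K. finite s) \<and> (\<forall>s\<in>K. \<forall>t. t \<subseteq> s \<longrightarrow> t \<in> K)"

definition simplices :: "nat \<Rightarrow> nat set set \<Rightarrow> nat set set" where
  "simplices i K = {s \<in> K. finite s \<and> card s = i + 1}"

definition faces :: "nat \<Rightarrow> nat set set \<Rightarrow> nat set set" where
  "faces n K = simplices (n - 1) K"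

definition bdry :: "nat set \<Rightarrow> nat set set" where
  "bdry \<tau> = {s. s \<subset> \<tau>}"

definition join :: "nat set set \<Rightarrow> nat set set \<Rightarrow> nat set set" where
  "join A B = {s \<union> t | s t. s \<in> A \<and> t \<in> B}"

definition link :: "nat set set \<Rightarrow> nat set \<Rightarrow> nat set set" where
  "link K \<tau> = {t. t \<inter> \<tau> = {} \<and> t \<union> \<tau> \<in> K}"

text \<open>Barycentric coordinates, with the topology of pointwise convergence; for a finite
  complex this is the usual topology of the realization.\<close>

definition geom_realization :: "nat set set \<Rightarrow> (nat \<Rightarrow> real) topology" where
  "geom_realization K = subtopology (powertop_real UNIV)
     {t. (\<forall>v. 0 \<le> t v) \<and> {v. t v \<noteq> 0} \<in> K \<and> (\<Sum>v | t v \<noteq> 0. t v) = 1}"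

definition topological_manifold :: "nat \<Rightarrow> 'a topology \<Rightarrow> bool" where
  "topological_manifold n X \<longleftrightarrow> Hausdorff_space X \<and> second_countable X \<and>
     (\<forall>x \<in> topspace X. \<exists>U V. openin X U \<and> x \<in> U \<and> openin (Euclidean_space n) V \<and>
        subtopology X U homeomorphic_space subtopology (Euclidean_space n) V)"

text \<open>An oriented simplex is a sign times the list of its vertices in increasing order.
  A chain is represented by its coefficient function on vertex lists; here is the
  coefficient of the list \<open>e\<close> in the \<open>k\<close>-th boundary of the list \<open>a\<close>.\<close>

definition iter_boundary :: "nat \<Rightarrow> nat list \<Rightarrow> nat list \<Rightarrow> int" where
  "iter_boundary k a e =
     (\<Sum>I | I \<subseteq> {..<length a} \<and> card I = k \<and> nths a (- I) = e. (-1) ^ (\<Sum>I))"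

text \<open>\<open>ori F\<close> is the sign of the oriented \<open>n\<close>-simplex \<open>F\<close> relative to the increasing
  order of its vertices; values of \<open>ori\<close> on other sets are irrelevant.\<close>

definition oriented_triangulated_manifold ::
    "nat \<Rightarrow> nat set set \<Rightarrow> (nat set \<Rightarrow> int) \<Rightarrow> bool" where
  "oriented_triangulated_manifold n K ori \<longleftrightarrow>
     finite K \<and> simplicial_complex K \<and> (\<exists>m. \<Union>K \<subseteq> {1..m}) \<and>
     topological_manifold n (geom_realization K) \<and> compact_space (geom_realization K) \<and>
     (\<forall>F \<in> simplices n K. ori F = 1 \<or> ori F = -1) \<and>
     (\<forall>e. (\<Sum>F \<in> simplices n K. ori F * iter_boundary 1 (sorted_list_of_set F) e) = 0)"


section \<open>The exchange matrix\<close>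

definition simplex_less :: "nat set \<Rightarrow> nat set \<Rightarrow> bool" where
  "simplex_less f g \<longleftrightarrow> (sorted_list_of_set f, sorted_list_of_set g) \<in> lexord {(i, j). i < j}"

definition edge_coeff :: "nat \<Rightarrow> (nat set \<Rightarrow> int) \<Rightarrow> nat set \<Rightarrow> nat set \<Rightarrow> nat set \<Rightarrow> int" where
  "edge_coeff n ori F f g =
     ori F * iter_boundary (n - 1) (sorted_list_of_set F) (sorted_list_of_set ((f \<union> g) - (f \<inter> g)))"

definition simplex_matrix ::
    "nat \<Rightarrow> (nat set \<Rightarrow> int) \<Rightarrow> nat set \<Rightarrow> nat set \<Rightarrow> nat set \<Rightarrow> int" where
  "simplex_matrix n ori F f g =
     (if f \<in> faces n (Pow F) \<and> g \<in> faces n (Pow F) then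
        (if simplex_less f g then edge_coeff n ori F f g
         else if simplex_less g f then - edge_coeff n ori F g f
         else 0)
      else 0)"

text \<open>A matrix indexed by \<open>faces n K\<close> is extended by \<open>0\<close> outside its index set.\<close>

definition exchange_matrix ::
    "nat \<Rightarrow> nat set set \<Rightarrow> (nat set \<Rightarrow> int) \<Rightarrow> nat set \<Rightarrow> nat set \<Rightarrow> int" where
  "exchange_matrix n K ori f g = (\<Sum>F \<in> simplices n K. simplex_matrix n ori F f g)"


section \<open>Bistellar moves\<close>

text \<open>\<open>Lam \<alpha> \<beta>\<close> is \<open>\<alpha> * \<partial>\<beta>\<close>, and \<open>Lam \<beta> \<alpha>\<close> is \<open>\<partial>\<alpha> * \<beta>\<close>.\<close>

definition Lam :: "nat set \<Rightarrow> nat set \<Rightarrow> nat set set" where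
  "Lam \<alpha> \<beta> = join (Pow \<alpha>) (bdry \<beta>)"

definition Dset :: "nat \<Rightarrow> nat set \<Rightarrow> nat set \<Rightarrow> nat set set" where
  "Dset n \<alpha> \<beta> = faces n (Lam \<alpha> \<beta>) - faces n (Lam \<beta> \<alpha>)"

definition bistellar_pair :: "nat \<Rightarrow> nat set set \<Rightarrow> nat set \<Rightarrow> nat set \<Rightarrow> bool" where
  "bistellar_pair h K \<alpha> \<beta> \<longleftrightarrow> \<alpha> \<in> K \<and> link K \<alpha> = bdry \<beta> \<and> \<beta> \<notin> K \<and>
     finite \<alpha> \<and> card \<alpha> = h + 1 \<and> finite \<beta> \<and> card \<beta> = h + 1"

definition bm :: "nat set set \<Rightarrow> nat set \<Rightarrow> nat set \<Rightarrow> nat set set" where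
  "bm K \<alpha> \<beta> = (K - Lam \<alpha> \<beta>) \<union> Lam \<beta> \<alpha>"

text \<open>For the normalized labelling only: the new \<open>n\<close>-simplices omit the vertex \<open>i + 1\<close>,
  where \<open>i \<le> h\<close>.\<close>

definition bm_orientation ::
    "nat \<Rightarrow> nat \<Rightarrow> nat set set \<Rightarrow> (nat set \<Rightarrow> int) \<Rightarrow> nat set \<Rightarrow> int" where
  "bm_orientation h n K ori F =
     (if F \<in> K then ori F else (-1) ^ (THE i. i \<le> h \<and> F = {1..n + 2} - {i + 1}))"

definition sig :: "nat \<Rightarrow> nat set \<Rightarrow> nat set" where
  "sig n f = (\<lambda>i. n + 3 - i) ` f"


section \<open>Semifields, the ambient field and seeds\<close>

text \<open>\<open>+\<close> is the auxiliary addition of the semifield; there is no zero.\<close>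

class semifield = comm_semiring + comm_monoid_mult + inverse +
  assumes semifield_left_inverse: "inverse a * a = 1"
    and semifield_divide: "a / b = a * inverse b"

text \<open>Seeds live in an arbitrary field \<open>'k\<close> containing the integral group ring of
  \<open>'p\<close>: \<open>\<iota>\<close> is the inclusion of the group, and its image being linearly
  independent over the integers says that the subring \<open>ZP \<iota>\<close> is the group ring.\<close>

definition group_ring_embedding :: "('p::semifield \<Rightarrow> 'k::field) \<Rightarrow> bool" where
  "group_ring_embedding \<iota> \<longleftrightarrow> \<iota> 1 = 1 \<and> (\<forall>p q. \<iota> (p * q) = \<iota> p * \<iota> q) \<and>
     (\<forall>S c. finite S \<and> (\<Sum>p\<in>S. of_int (c p) * \<iota> p) = 0 \<longrightarrow> (\<forall>p\<in>S. c p = (0::int)))"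

definition ZP :: "('p::semifield \<Rightarrow> 'k::field) \<Rightarrow> 'k set" where
  "ZP \<iota> = {\<Sum>p\<in>S. of_int (c p) * \<iota> p | S (c :: 'p \<Rightarrow> int). finite S}"

text \<open>Monomials in the variables \<open>x\<^sub>f\<close> are multisets of simplices.  Divisibility is
  \<open>\<subseteq>#\<close>, so the least common multiple is \<open>\<union>#\<close>.\<close>

definition monomial_value :: "(nat set \<Rightarrow> 'k::field) \<Rightarrow> nat set multiset \<Rightarrow> 'k" where
  "monomial_value x m = (\<Prod>f\<in>#m. x f)"

definition algebraically_independent ::
    "'k::field set \<Rightarrow> nat set set \<Rightarrow> (nat set \<Rightarrow> 'k) \<Rightarrow> bool" where
  "algebraically_independent R I x \<longleftrightarrow>
     (\<forall>M c. finite M \<and> (\<forall>m\<in>M. set_mset m \<subseteq> I \<and> c m \<in> R) \<and>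
        (\<Sum>m\<in>M. c m * monomial_value x m) = 0 \<longrightarrow> (\<forall>m\<in>M. c m = 0))"

record ('k, 'p) seed =
  cluster :: "nat set \<Rightarrow> 'k"
  pplus :: "nat set \<Rightarrow> 'p"
  pminus :: "nat set \<Rightarrow> 'p"
  exmat :: "nat set \<Rightarrow> nat set \<Rightarrow> int"

text \<open>The families are indexed by \<open>faces n K\<close>; \<open>extensional\<close> fixes the irrelevant
  values elsewhere, so that equality of records is equality of seeds.\<close>

definition seeds :: "('p::semifield \<Rightarrow> 'k::field) \<Rightarrow> nat \<Rightarrow> nat set set \<Rightarrow> (nat set \<Rightarrow> int) \<Rightarrow>
    ('k, 'p) seed set" where
  "seeds \<iota> n K ori = {\<Sigma>.
     cluster \<Sigma> \<in> extensional (faces n K) \<and>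
     algebraically_independent (ZP \<iota>) (faces n K) (cluster \<Sigma>) \<and>
     pplus \<Sigma> \<in> extensional (faces n K) \<and> pminus \<Sigma> \<in> extensional (faces n K) \<and>
     (\<forall>f \<in> faces n K. pplus \<Sigma> f + pminus \<Sigma> f = 1) \<and>
     exmat \<Sigma> = exchange_matrix n K ori}"


section \<open>Bistellar seed mutation\<close>

text \<open>The bijection of clusters, on the indices of the cluster variables.\<close>

definition phi :: "nat \<Rightarrow> nat set \<Rightarrow> nat set \<Rightarrow> nat set \<Rightarrow> nat set" where
  "phi n \<alpha> \<beta> f = (if f \<in> faces n (Lam \<alpha> \<beta>) then sig n f else f)"

text \<open>\<open>exch_monomial\<close> is \<open>M\<^sup>+\<close> for \<open>\<epsilon> = 1\<close> and \<open>M\<^sup>-\<close> for \<open>\<epsilon> = -1\<close>.  Note that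
  \<open>nat b\<close> is \<open>max b 0\<close>.\<close>

definition lcm_part :: "nat \<Rightarrow> nat set \<Rightarrow> nat set \<Rightarrow> (nat set \<Rightarrow> nat set \<Rightarrow> int) \<Rightarrow> int \<Rightarrow>
    nat set \<Rightarrow> nat set multiset" where
  "lcm_part n \<alpha> \<beta> b \<epsilon> f =
     (\<Sum>g \<in> faces n (Lam \<alpha> \<beta>) - Dset n \<alpha> \<beta>. replicate_mset (nat (\<epsilon> * b f g)) g) \<union>#
     (\<Sum>g \<in> faces n (Lam \<alpha> \<beta>) - Dset n \<alpha> \<beta>. replicate_mset (nat (\<epsilon> * b f g)) (sig n g))"

definition denominator :: "nat \<Rightarrow> nat set \<Rightarrow> nat set \<Rightarrow> (nat set \<Rightarrow> nat set \<Rightarrow> int) \<Rightarrow>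
    nat set \<Rightarrow> nat set multiset" where
  "denominator n \<alpha> \<beta> b f =
     (\<Sum>g \<in> {g \<in> faces n (Lam \<alpha> \<beta>) - Dset n \<alpha> \<beta>. b f g > 0 \<and> b f (sig n g) < 0}.
        replicate_mset (nat (b f g)) g + replicate_mset (nat (b f g)) (sig n g))"

definition exch_monomial :: "('p::semifield \<Rightarrow> 'k::field) \<Rightarrow> nat \<Rightarrow> nat set \<Rightarrow> nat set \<Rightarrow>
    ('k, 'p) seed \<Rightarrow> int \<Rightarrow> nat set \<Rightarrow> 'k" where
  "exch_monomial \<iota> n \<alpha> \<beta> \<Sigma> \<epsilon> f =
     \<iota> (if \<epsilon> = 1 then pplus \<Sigma> f else pminus \<Sigma> f)
       / monomial_value (cluster \<Sigma>) (denominator n \<alpha> \<beta> (exmat \<Sigma>) f)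
       * monomial_value (cluster \<Sigma>) (lcm_part n \<alpha> \<beta> (exmat \<Sigma>) \<epsilon> f)"

text \<open>\<open>x\<^sub>g\<close> for \<open>g \<in> Dset n \<beta> \<alpha>\<close> is determined by the exchange relation of
  \<open>f = \<sigma>(g) \<in> Dset n \<alpha> \<beta>\<close>; all other variables \<open>x\<^sub>g\<close> are common to both clusters.\<close>

definition mutate_cluster :: "('p::semifield \<Rightarrow> 'k::field) \<Rightarrow> nat \<Rightarrow> nat set set \<Rightarrow>
    nat set \<Rightarrow> nat set \<Rightarrow> ('k, 'p) seed \<Rightarrow> nat set \<Rightarrow> 'k" where
  "mutate_cluster \<iota> n K \<alpha> \<beta> \<Sigma> = (\<lambda>g \<in> faces n (bm K \<alpha> \<beta>).
     if g \<in> Dset n \<beta> \<alpha> then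
       (exch_monomial \<iota> n \<alpha> \<beta> \<Sigma> 1 (sig n g) + exch_monomial \<iota> n \<alpha> \<beta> \<Sigma> (-1) (sig n g))
         / cluster \<Sigma> (sig n g)
     else cluster \<Sigma> g)"

definition u_coeff :: "('k, 'p::semifield) seed \<Rightarrow> nat set \<Rightarrow> 'p" where
  "u_coeff \<Sigma> f = pplus \<Sigma> f / pminus \<Sigma> f"

definition pi_coeff :: "nat \<Rightarrow> nat set \<Rightarrow> nat set \<Rightarrow> ('k, 'p::semifield) seed \<Rightarrow>
    nat set \<Rightarrow> 'p" where
  "pi_coeff n \<alpha> \<beta> \<Sigma> f = (\<Prod>g \<in> Dset n \<alpha> \<beta>.
     pplus \<Sigma> g ^ nat (exmat \<Sigma> g f) * inverse (pminus \<Sigma> g ^ nat (- exmat \<Sigma> g f)))"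

definition mutate_u :: "nat \<Rightarrow> nat set \<Rightarrow> nat set \<Rightarrow> ('k, 'p::semifield) seed \<Rightarrow>
    nat set \<Rightarrow> 'p" where
  "mutate_u n \<alpha> \<beta> \<Sigma> f =
     (if f \<in> Dset n \<beta> \<alpha> then inverse (u_coeff \<Sigma> (sig n f))
      else if f \<in> faces n (Lam \<beta> \<alpha>) then pi_coeff n \<alpha> \<beta> \<Sigma> (sig n f) * u_coeff \<Sigma> (sig n f)
      else u_coeff \<Sigma> f)"

definition normalized_pair :: "'p::semifield \<Rightarrow> 'p \<times> 'p" where
  "normalized_pair u = (THE q. fst q + snd q = 1 \<and> fst q / snd q = u)"

definition mutate_matrix :: "nat \<Rightarrow> nat set set \<Rightarrow> nat set \<Rightarrow> nat set \<Rightarrow>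
    (nat set \<Rightarrow> nat set \<Rightarrow> int) \<Rightarrow> nat set \<Rightarrow> nat set \<Rightarrow> int" where
  "mutate_matrix n K \<alpha> \<beta> b f g =
     (if f \<notin> faces n (bm K \<alpha> \<beta>) \<or> g \<notin> faces n (bm K \<alpha> \<beta>) then 0
      else if f \<in> faces n (Lam \<beta> \<alpha>) \<and> g \<in> faces n (Lam \<beta> \<alpha>) then - b (sig n f) (sig n g)
      else if f \<in> faces n K \<and> g \<in> faces n K then b f g
      else 0)"

definition seed_mutation :: "('p::semifield \<Rightarrow> 'k::field) \<Rightarrow> nat \<Rightarrow> nat set set \<Rightarrow>
    nat set \<Rightarrow> nat set \<Rightarrow> ('k, 'p) seed \<Rightarrow> ('k, 'p) seed" where
  "seed_mutation \<iota> n K \<alpha> \<beta> \<Sigma> = \<lparr>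
     cluster = mutate_cluster \<iota> n K \<alpha> \<beta> \<Sigma>,
     pplus = (\<lambda>f \<in> faces n (bm K \<alpha> \<beta>). fst (normalized_pair (mutate_u n \<alpha> \<beta> \<Sigma> f))),
     pminus = (\<lambda>f \<in> faces n (bm K \<alpha> \<beta>). snd (normalized_pair (mutate_u n \<alpha> \<beta> \<Sigma> f))),
     exmat = mutate_matrix n K \<alpha> \<beta> (exmat \<Sigma>)\<rparr>"

lemma normalized_pair_unique:
  fixes u :: "'p::semifield"
  shows "\<exists>!q. fst q + snd q = 1 \<and> fst q / snd q = u"
proof -
  have l: "inverse a * a = 1" for a :: 'p
    by (rule semifield_left_inverse)
  have r: "a * inverse a = 1" for a :: 'p
    using l[of a] by (simp only: mult.commute)
  let ?b = "inverse (u + 1)"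
  have 1: "u * ?b + ?b = 1"
    using distrib_right[of u 1 ?b] r[of "u + 1"] by simp
  have 2: "(u * ?b) / ?b = u"
    by (simp only: semifield_divide mult.assoc r mult_1_right)
  show ?thesis
  proof (rule ex1I[of _ "(u * ?b, ?b)"])
    fix q :: "'p \<times> 'p" assume q: "fst q + snd q = 1 \<and> fst q / snd q = u"
    have "fst q / snd q * snd q = fst q"
      by (simp only: semifield_divide mult.assoc l mult_1_right)
    with q have a: "fst q = u * snd q" by simp
    have "(u + 1) * snd q = 1"
      using q a distrib_right[of u 1 "snd q"] by simp
    hence "?b * ((u + 1) * snd q) = ?b" by simp
    hence "snd q = ?b" by (simp only: mult.assoc[symmetric] l mult_1_left)
    with a show "q = (u * ?b, ?b)" by (simp add: prod_eq_iff)
  qed (use 1 2 in simp)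
qed

end

(*
  The 2h + 2 vertices of alpha and beta span a subcomplex of K and of L that is
  alpha * (boundary of beta) in K and (boundary of alpha) * beta in L, and K and L agree
  elsewhere.  The situation is therefore symmetric in (K, alpha) and (L, beta), and it is
  enough to show that Phi_beta undoes Phi_alpha.  Since n is even, the reversal sigma
  preserves the signs in iterated boundaries and the orientations, but it reverses the
  lexicographic order of two facets of one simplex, so b^L(sigma f, sigma g) = - b^K(f, g).
  Hence M^+ and M^- are exchanged (the denominators agree because all entries of the
  matrices lie in {-1, 0, 1}), the factors pi of the two mutations are inverse to each
  other, and both exchange relations read x_f x_(sigma f) = P_f with the same P_f.  That
  the new cluster is algebraically independent follows over the ring of polynomials in the
  common variables, which contains the numerators and denominators of the P_f: multiplying
  a relation by a large monomial in the x_f turns the inverses 1 / x_f into powers of x_f.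
*)
theory Submission
  imports Defs
begin

subsection \<open>Algebraic independence\<close>

lemma monomial_value_simps [simp]:
  "monomial_value x {#} = 1"
  "monomial_value x (m + k) = monomial_value x m * monomial_value x k"
  "monomial_value x (add_mset f m) = x f * monomial_value x m"
  by (simp_all add: monomial_value_def)

lemma monomial_value_cong:
  assumes "\<And>f. f \<in># m \<Longrightarrow> x f = y f"
  shows "monomial_value x m = monomial_value y m"
  unfolding monomial_value_def using assms by (metis image_mset_cong)

lemma monomial_value_mult:
  "monomial_value (\<lambda>f. x f * y f) m = monomial_value x m * monomial_value y m"
  by (simp add: monomial_value_def prod_mset.distrib)

lemma monomial_value_nonzero:
  assumes "\<And>f. f \<in># m \<Longrightarrow> x f \<noteq> 0"
  shows "monomial_value x m \<noteq> 0"
  using assms by (induction m) auto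

text \<open>Despite the name, closure under negation is not included: coefficients are only ever
  added and multiplied.\<close>

definition subring :: "'k::field set \<Rightarrow> bool" where
  "subring R \<longleftrightarrow> 0 \<in> R \<and> 1 \<in> R \<and> (\<forall>a\<in>R. \<forall>b\<in>R. a + b \<in> R \<and> a * b \<in> R)"

text \<open>One frame for two rings: group elements over the image of the integers give
  \<open>ZP \<iota>\<close>, and monomials over \<open>ZP \<iota>\<close> give the values of
  polynomials.\<close>

definition combinations :: "'k::field set \<Rightarrow> ('i \<Rightarrow> 'k) \<Rightarrow> 'i set \<Rightarrow> 'k set" where
  "combinations R \<phi> I = {\<Sum>i\<in>S. c i * \<phi> i | S c. finite S \<and> S \<subseteq> I \<and> (\<forall>i\<in>S. c i \<in> R)}"

lemma combinationsE:
  assumes "a \<in> combinations R \<phi> I"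
  obtains S c where "finite S" "S \<subseteq> I" "\<forall>i\<in>S. c i \<in> R" "a = (\<Sum>i\<in>S. c i * \<phi> i)"
  using assms unfolding combinations_def by blast

lemma combinations_term:
  assumes "i \<in> I" "a \<in> R"
  shows "a * \<phi> i \<in> combinations R \<phi> I"
  unfolding combinations_def using assms
  by (intro CollectI exI[of _ "{i}"] exI[of _ "\<lambda>_. a"]) auto

lemma combinations_add:
  assumes R: "subring R" and "a \<in> combinations R \<phi> I" "b \<in> combinations R \<phi> I"
  shows "a + b \<in> combinations R \<phi> I"
proof -
  obtain S c where S: "finite S" "S \<subseteq> I" "\<forall>i\<in>S. c i \<in> R" and a: "a = (\<Sum>i\<in>S. c i * \<phi> i)"
    using assms(2) by (rule combinationsE)
  obtain T d where T: "finite T" "T \<subseteq> I" "\<forall>i\<in>T. d i \<in> R" and b: "b = (\<Sum>i\<in>T. d i * \<phi> i)"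
    using assms(3) by (rule combinationsE)
  let ?c = "\<lambda>i. if i \<in> S then c i else 0" and ?d = "\<lambda>i. if i \<in> T then d i else 0"
  have "a = (\<Sum>i\<in>S \<union> T. ?c i * \<phi> i)" "b = (\<Sum>i\<in>S \<union> T. ?d i * \<phi> i)"
    unfolding a b using S(1) T(1) by (auto intro!: sum.mono_neutral_cong_left)
  then have "a + b = (\<Sum>i\<in>S \<union> T. (?c i + ?d i) * \<phi> i)"
    by (simp only: sum.distrib distrib_right)
  moreover have "\<forall>i\<in>S \<union> T. ?c i + ?d i \<in> R"
    using R S(3) T(3) by (auto simp: subring_def)
  ultimately show ?thesis
    unfolding combinations_def using S T
    by (intro CollectI exI[of _ "S \<union> T"] exI[of _ "\<lambda>i. ?c i + ?d i"]) auto
qed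

lemma combinations_sum:
  assumes R: "subring R" and "\<And>j. j \<in> T \<Longrightarrow> a j \<in> combinations R \<phi> I"
  shows "sum a T \<in> combinations R \<phi> I"
proof -
  have "(0::'a) \<in> combinations R \<phi> I"
    unfolding combinations_def by (intro CollectI exI[of _ "{}"]) auto
  then show ?thesis
    using assms(2) by (induction T rule: infinite_finite_induct) (auto intro: combinations_add[OF R])
qed

text \<open>The argument for monoid rings: \<open>\<phi>\<close> turns \<open>op\<close> into
  multiplication, so expanding a product of combinations gives terms of the same kind. Different
  pairs may share an index \<open>op i j\<close>, so the terms are added as combinations instead of
  being put over one index set.\<close>

lemma subring_combinations:
  assumes R: "subring R" and one: "e \<in> I" "\<phi> e = 1"
    and mult: "\<And>i j. i \<in> I \<Longrightarrow> j \<in> I \<Longrightarrow> op i j \<in> I \<and> \<phi> (op i j) = \<phi> i * \<phi> j"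
  shows "subring (combinations R \<phi> I)"
proof -
  have "a * b \<in> combinations R \<phi> I"
    if ab: "a \<in> combinations R \<phi> I" "b \<in> combinations R \<phi> I" for a b
  proof -
    obtain S c where S: "finite S" "S \<subseteq> I" "\<forall>i\<in>S. c i \<in> R" and a: "a = (\<Sum>i\<in>S. c i * \<phi> i)"
      using ab(1) by (rule combinationsE)
    obtain T d where T: "finite T" "T \<subseteq> I" "\<forall>i\<in>T. d i \<in> R" and b: "b = (\<Sum>i\<in>T. d i * \<phi> i)"
      using ab(2) by (rule combinationsE)
    have "a * b = (\<Sum>i\<in>S. \<Sum>j\<in>T. (c i * d j) * \<phi> (op i j))"
      unfolding a b sum_product
    proof (intro sum.cong refl)
      fix i j assume "i \<in> S" "j \<in> T"
      then have "\<phi> (op i j) = \<phi> i * \<phi> j" using mult S(2) T(2) by blast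
      then show "c i * \<phi> i * (d j * \<phi> j) = c i * d j * \<phi> (op i j)" by (simp add: mult_ac)
    qed
    also have "\<dots> \<in> combinations R \<phi> I"
    proof (intro combinations_sum[OF R])
      fix i j assume ij: "i \<in> S" "j \<in> T"
      then have "op i j \<in> I" using mult S(2) T(2) by blast
      moreover have "c i * d j \<in> R" using ij S(3) T(3) R unfolding subring_def by blast
      ultimately show "c i * d j * \<phi> (op i j) \<in> combinations R \<phi> I"
        by (rule combinations_term)
    qed
    finally show ?thesis .
  qed
  moreover have "0 \<in> combinations R \<phi> I"
    using combinations_sum[OF R, of "{}"] by simp
  moreover have "1 \<in> combinations R \<phi> I"
    using combinations_term[of e I 1 R \<phi>] one R by (simp add: subring_def)
  ultimately show ?thesis
    unfolding subring_def using combinations_add[OF R, of _ \<phi> I] by simp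
qed

section \<open>The group ring inside the ambient field\<close>

lemma subring_ZP:
  assumes "group_ring_embedding \<iota>"
  shows "subring (ZP \<iota>)"
proof -
  have "ZP \<iota> = combinations (range of_int) \<iota> UNIV" (is "?L = ?R")
  proof
    show "?L \<subseteq> ?R"
    proof
      fix a assume "a \<in> ?L"
      then obtain S and c :: "'a \<Rightarrow> int" where "finite S" "a = (\<Sum>p\<in>S. of_int (c p) * \<iota> p)"
        unfolding ZP_def by blast
      then show "a \<in> ?R"
        unfolding combinations_def
        by (intro CollectI exI[of _ S] exI[of _ "\<lambda>p. of_int (c p)"]) auto
    qed
    show "?R \<subseteq> ?L"
    proof
      fix a assume "a \<in> ?R"
      then obtain S c where S: "finite S" "\<forall>i\<in>S. c i \<in> range of_int" and a: "a = (\<Sum>i\<in>S. c i * \<iota> i)"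
        unfolding combinations_def by blast
      then obtain d :: "_ \<Rightarrow> int" where "\<forall>i\<in>S. c i = of_int (d i)"
        unfolding image_def by simp metis
      with a have "a = (\<Sum>i\<in>S. of_int (d i) * \<iota> i)" by simp
      with S(1) show "a \<in> ?L" unfolding ZP_def by blast
    qed
  qed
  moreover have "subring (range of_int)"
    unfolding subring_def by (auto simp flip: of_int_add of_int_mult) (metis of_int_0 rangeI, metis of_int_1 rangeI)
  ultimately show ?thesis
    using assms subring_combinations[of "range of_int" 1 UNIV \<iota> "(*)"]
    by (simp add: group_ring_embedding_def)
qed

lemma group_ring_embedding_in_ZP: "\<iota> p \<in> ZP \<iota>"
  unfolding ZP_def by (intro CollectI exI[of _ "{p}"] exI[of _ "\<lambda>_. 1"]) simp

lemma group_ring_embeddingD: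
  fixes c :: "_ \<Rightarrow> int"
  assumes "group_ring_embedding \<iota>" "finite S" "(\<Sum>p\<in>S. of_int (c p) * \<iota> p) = 0" "p \<in> S"
  shows "c p = 0"
proof -
  have "\<forall>S c. finite S \<and> (\<Sum>p\<in>S. of_int (c p) * \<iota> p) = 0 \<longrightarrow> (\<forall>p\<in>S. c p = (0::int))"
    using assms(1) unfolding group_ring_embedding_def by simp
  from this[rule_format, of S c p] show ?thesis using assms(2-4) by simp
qed

lemma group_ring_embedding_nonzero:
  assumes "group_ring_embedding \<iota>"
  shows "\<iota> p \<noteq> 0"
  using group_ring_embeddingD[OF assms, of "{p}" "\<lambda>_. 1" p] by auto

lemma group_ring_embedding_add_nonzero:
  assumes "group_ring_embedding \<iota>"
  shows "\<iota> p + \<iota> q \<noteq> 0"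
proof
  assume 0: "\<iota> p + \<iota> q = 0"
  \<comment> \<open>If \<open>p = q\<close>, the set \<open>{p, q}\<close> collapses to a singleton
    and the relation reads 2 * \<open>\<iota> p\<close> = 0, hence the coefficient 2.\<close>
  define c :: "_ \<Rightarrow> int" where "c r = (if p = q then 2 else 1)" for r :: 'a
  have "(\<Sum>r\<in>{p, q}. of_int (c r) * \<iota> r) = 0"
    using 0 by (auto simp: c_def)
  then have "c p = 0"
    by (rule group_ring_embeddingD[OF assms, rotated]) auto
  then show False by (auto simp: c_def split: if_splits)
qed

text \<open>Polynomials are represented by their values in the field. A polynomial ring over a
  polynomial ring is then again a set of field elements, and
  \<open>algebraically_independent\<close> applies to it as a coefficient ring.\<close>

abbreviation polynomial_values :: "'k::field set \<Rightarrow> nat set set \<Rightarrow> (nat set \<Rightarrow> 'k) \<Rightarrow> 'k set" where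
  "polynomial_values R J x \<equiv> combinations R (monomial_value x) {m. set_mset m \<subseteq> J}"

lemma subring_polynomial_values: "subring R \<Longrightarrow> subring (polynomial_values R J x)"
  by (rule subring_combinations[of _ "{#}" _ _ "(+)"]) auto

lemma algebraically_independentD:
  assumes "algebraically_independent R I x" "finite M" "\<And>m. m \<in> M \<Longrightarrow> set_mset m \<subseteq> I"
    "\<And>m. m \<in> M \<Longrightarrow> c m \<in> R" "(\<Sum>m\<in>M. c m * monomial_value x m) = 0" "m \<in> M"
  shows "c m = 0"
  using assms unfolding algebraically_independent_def by blast

lemma algebraically_independent_mono:
  "algebraically_independent R I x \<Longrightarrow> J \<subseteq> I \<Longrightarrow> algebraically_independent R J x"
  unfolding algebraically_independent_def by (meson order_trans)

lemma algebraically_independent_nonzero: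
  assumes "algebraically_independent R I x" "1 \<in> R" "f \<in> I"
  shows "x f \<noteq> 0"
proof
  assume "x f = 0"
  then show False
    using algebraically_independentD[of R I x "{{#f#}}" "\<lambda>_. 1" "{#f#}"] assms by simp
qed

lemma algebraically_independent_cong:
  assumes "\<And>f. f \<in> I \<Longrightarrow> x f = y f"
  shows "algebraically_independent R I x \<longleftrightarrow> algebraically_independent R I y"
proof -
  have *: "algebraically_independent R I x"
    if ind: "algebraically_independent R I y" and eq: "\<And>f. f \<in> I \<Longrightarrow> x f = y f" for x y
  proof -
    have "(\<Sum>m\<in>M. c m * monomial_value x m) = (\<Sum>m\<in>M. c m * monomial_value y m)"
      if "\<forall>m\<in>M. set_mset m \<subseteq> I" for c and M
      using that eq by (intro sum.cong refl arg_cong2[where f = "(*)"] monomial_value_cong) auto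
    then show ?thesis
      using ind unfolding algebraically_independent_def by (metis (no_types, lifting))
  qed
  show ?thesis using *[of x y] *[of y x] assms by metis
qed

text \<open>An injective renaming of variables keeps distinct monomials distinct. With
  \<open>s = sig n\<close> it carries the inverted variables to their new indices.\<close>

lemma algebraically_independent_reindex:
  assumes ind: "algebraically_independent R I x" and s: "inj_on s I'" "s ` I' \<subseteq> I"
  shows "algebraically_independent R I' (x \<circ> s)"
  unfolding algebraically_independent_def
proof (intro allI impI)
  fix M c assume "finite M \<and> (\<forall>m\<in>M. set_mset m \<subseteq> I' \<and> c m \<in> R) \<and>
    (\<Sum>m\<in>M. c m * monomial_value (x \<circ> s) m) = 0"
  then have fin: "finite M" and M: "\<And>m. m \<in> M \<Longrightarrow> set_mset m \<subseteq> I'" "\<And>m. m \<in> M \<Longrightarrow> c m \<in> R"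
    and sum0: "(\<Sum>m\<in>M. c m * monomial_value (x \<circ> s) m) = 0" by auto
  define t where "t = inv_into I' s"
  have t: "image_mset t (image_mset s m) = m" if "m \<in> M" for m
    using s(1) M(1)[OF that] by (auto simp: t_def multiset.map_comp subset_iff intro!: multiset.map_ident_strong)
  have inj: "inj_on (image_mset s) M"
    using t by (metis inj_on_inverseI)
  have "(\<Sum>m\<in>image_mset s ` M. c (image_mset t m) * monomial_value x m) =
      (\<Sum>m\<in>M. c m * monomial_value (x \<circ> s) m)"
    unfolding sum.reindex[OF inj]
    by (intro sum.cong refl) (simp only: comp_apply t, simp add: monomial_value_def multiset.map_comp comp_def)
  then have "(\<Sum>m\<in>image_mset s ` M. c (image_mset t m) * monomial_value x m) = 0"
    using sum0 by simp
  then have "c (image_mset t (image_mset s m)) = 0" if "m \<in> M" for m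
    using algebraically_independentD[OF ind, of "image_mset s ` M" "\<lambda>m. c (image_mset t m)" "image_mset s m"]
      fin M s(2) that by (fastforce simp: t)
  then show "\<forall>m\<in>M. c m = 0" using t by simp
qed

text \<open>Distinct monomials are handled by algebraic independence and the nonzero coefficient
  \<open>\<iota> p\<close>. For equal ones the coefficient is \<open>\<iota> p + \<iota> q\<close>,
  which is nonzero by the group ring property.\<close>

lemma binomial_nonzero:
  assumes \<iota>: "group_ring_embedding \<iota>" and ind: "algebraically_independent (ZP \<iota>) I x"
    and "set_mset m \<subseteq> I" "set_mset k \<subseteq> I"
  shows "\<iota> p * monomial_value x m + \<iota> q * monomial_value x k \<noteq> 0"
proof (cases "m = k")
  case True
  have R: "subring (ZP \<iota>)" by (rule subring_ZP[OF \<iota>])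
  have "\<iota> p + \<iota> q \<in> ZP \<iota>"
    using R group_ring_embedding_in_ZP unfolding subring_def by blast
  then have "(\<iota> p + \<iota> q) * monomial_value x m \<noteq> 0"
    using algebraically_independentD[OF ind, of "{m}" "\<lambda>_. \<iota> p + \<iota> q" m]
      group_ring_embedding_add_nonzero[OF \<iota>] assms(3) by auto
  then show ?thesis using True by (simp add: distrib_right)
next
  case False
  let ?c = "\<lambda>l. if l = m then \<iota> p else \<iota> q"
  show ?thesis
  proof
    assume "\<iota> p * monomial_value x m + \<iota> q * monomial_value x k = 0"
    then have "(\<Sum>l\<in>{m, k}. ?c l * monomial_value x l) = 0" using False by simp
    then have "?c m = 0"
      by (rule algebraically_independentD[OF ind, rotated 3])
        (use assms(3,4) group_ring_embedding_in_ZP in auto)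
    then show False using group_ring_embedding_nonzero[OF \<iota>] by simp
  qed
qed

section \<open>Algebraic independence over a ring of polynomials\<close>

lemma filter_mset_add_disjoint:
  assumes "set_mset m \<subseteq> D" "set_mset k \<subseteq> J" "J \<inter> D = {}"
  shows "filter_mset (\<lambda>f. f \<in> D) (m + k) = m" "filter_mset (\<lambda>f. f \<notin> D) (m + k) = k"
proof -
  have "filter_mset (\<lambda>f. f \<in> D) m = m" "filter_mset (\<lambda>f. f \<in> D) k = {#}"
    "filter_mset (\<lambda>f. f \<notin> D) m = {#}" "filter_mset (\<lambda>f. f \<notin> D) k = k"
    using assms unfolding disjoint_iff by (auto intro!: multiset_eqI simp: count_eq_zero_iff subset_iff)
  then show "filter_mset (\<lambda>f. f \<in> D) (m + k) = m" "filter_mset (\<lambda>f. f \<notin> D) (m + k) = k"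
    by simp_all
qed

text \<open>Expanding the coefficients of a relation in the variables of \<open>D\<close> gives a
  relation over \<open>R\<close> in all variables. Since \<open>J\<close> and \<open>D\<close> are
  disjoint, each monomial splits uniquely into its two parts, so no terms merge in the
  expansion.\<close>

lemma algebraically_independent_tower:
  assumes ind: "algebraically_independent R (J \<union> D) x" and disj: "J \<inter> D = {}"
  shows "algebraically_independent (polynomial_values R J x) D x"
  unfolding algebraically_independent_def
proof (intro allI impI)
  fix M a assume *: "finite M \<and> (\<forall>m\<in>M. set_mset m \<subseteq> D \<and> a m \<in> polynomial_values R J x) \<and>
    (\<Sum>m\<in>M. a m * monomial_value x m) = 0"
  let ?v = "monomial_value x"
  have "\<forall>m\<in>M. \<exists>N c. finite N \<and> (\<forall>k\<in>N. set_mset k \<subseteq> J \<and> c k \<in> R) \<and> a m = (\<Sum>k\<in>N. c k * ?v k)"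
    using * unfolding combinations_def by (simp add: subset_iff) (smt (verit))
  then obtain N c where N: "\<And>m. m \<in> M \<Longrightarrow> finite (N m)"
      "\<And>m k. m \<in> M \<Longrightarrow> k \<in> N m \<Longrightarrow> set_mset k \<subseteq> J \<and> c m k \<in> R"
      "\<And>m. m \<in> M \<Longrightarrow> a m = (\<Sum>k\<in>N m. c m k * ?v k)"
    by metis
  have split: "filter_mset (\<lambda>f. f \<in> D) (m + k) = m \<and> filter_mset (\<lambda>f. f \<notin> D) (m + k) = k"
    if "m \<in> M" "k \<in> N m" for m k
    using filter_mset_add_disjoint[of m D k J] that * N(2) disj by auto
  \<comment> \<open>A term of the expanded relation is recognised from its monomial: the
    \<open>D\<close>-part names the outer term, the remaining part the inner one.\<close>
  define c' where "c' l = c (filter_mset (\<lambda>f. f \<in> D) l) (filter_mset (\<lambda>f. f \<notin> D) l)" for l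
  have inj: "inj_on (\<lambda>(m, k). m + k) (Sigma M N)"
  proof (rule inj_onI, clarify)
    fix m k m' k' assume "m \<in> M" "k \<in> N m" "m' \<in> M" "k' \<in> N m'" "m + k = m' + k'"
    then show "m = m' \<and> k = k'" using split by metis
  qed
  have "0 = (\<Sum>m\<in>M. \<Sum>k\<in>N m. c m k * (?v m * ?v k))"
    using * N(3) by (simp add: sum_distrib_left sum_distrib_right mult_ac cong: sum.cong)
  also have "\<dots> = (\<Sum>(m, k)\<in>Sigma M N. c m k * (?v m * ?v k))"
    using * N(1) by (subst sum.Sigma) auto
  also have "\<dots> = (\<Sum>l\<in>(\<lambda>(m, k). m + k) ` Sigma M N. c' l * ?v l)"
    unfolding sum.reindex[OF inj] using split by (intro sum.cong) (auto simp: c'_def)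
  finally have sum0: "(\<Sum>l\<in>(\<lambda>(m, k). m + k) ` Sigma M N. c' l * ?v l) = 0" by simp
  have "c' (m + k) = 0" if "m \<in> M" "k \<in> N m" for m k
  proof (rule algebraically_independentD[OF ind _ _ _ sum0])
    show "finite ((\<lambda>(m, k). m + k) ` Sigma M N)" using * N(1) by auto
    show "m + k \<in> (\<lambda>(m, k). m + k) ` Sigma M N" using that by force
    show "set_mset l \<subseteq> J \<union> D" if "l \<in> (\<lambda>(m, k). m + k) ` Sigma M N" for l
      using that * N(2) by fastforce
    show "c' l \<in> R" if "l \<in> (\<lambda>(m, k). m + k) ` Sigma M N" for l
      using that N(2) split by (auto simp: c'_def)
  qed
  then have "c m k = 0" if "m \<in> M" "k \<in> N m" for m k
    using that split by (auto simp: c'_def)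
  then show "\<forall>m\<in>M. a m = 0" using N(3) by simp
qed

text \<open>The terms of a relation are grouped by the \<open>D\<close>-part of their monomials. The
  collected coefficients vanish by independence over the polynomial ring, and each of them is a
  relation in the variables of \<open>J\<close>, which vanishes term by term.\<close>

lemma algebraically_independent_tower_conv:
  assumes indJ: "algebraically_independent R J x"
    and indD: "algebraically_independent (polynomial_values R J x) D x"
  shows "algebraically_independent R (J \<union> D) x"
  unfolding algebraically_independent_def
proof (intro allI impI)
  fix M c assume *: "finite M \<and> (\<forall>m\<in>M. set_mset m \<subseteq> J \<union> D \<and> c m \<in> R) \<and>
    (\<Sum>m\<in>M. c m * monomial_value x m) = 0"
  let ?v = "monomial_value x"
  let ?d = "filter_mset (\<lambda>f. f \<in> D)" and ?j = "filter_mset (\<lambda>f. f \<notin> D)"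
  have part: "l = ?d l + ?j l" for l by (rule multiset_partition)
  define N where "N m = {l \<in> M. ?d l = m}" for m
  have finN: "finite (N m)" for m using * by (simp add: N_def)
  have N_eq: "l = m + ?j l" if "l \<in> N m" for l m
    using part that unfolding N_def by blast
  have inj: "inj_on ?j (N m)" for m by (rule inj_onI) (metis N_eq)
  define a where "a m = (\<Sum>l\<in>N m. c l * ?v (?j l))" for m
  have a_eq: "a m = (\<Sum>k\<in>?j ` N m. c (m + k) * ?v k)" for m
    unfolding a_def sum.reindex[OF inj] using N_eq by (intro sum.cong) auto
  have k: "set_mset k \<subseteq> J \<and> c (m + k) \<in> R" if "k \<in> ?j ` N m" for m k
    using that * N_eq by (fastforce simp: N_def)
  have aR: "a m \<in> polynomial_values R J x" for m
    unfolding combinations_def a_eq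
  proof (intro CollectI exI conjI)
    show "finite (?j ` N m)" using finN by simp
    show "?j ` N m \<subseteq> {k. set_mset k \<subseteq> J}" "\<forall>k\<in>?j ` N m. c (m + k) \<in> R" using k by blast+
  qed (rule refl)
  have "0 = (\<Sum>l\<in>M. c l * ?v l)" using * by simp
  also have "\<dots> = (\<Sum>m\<in>?d ` M. \<Sum>l\<in>N m. c l * ?v l)"
    unfolding N_def using * by (intro sum.image_gen) simp
  also have "\<dots> = (\<Sum>m\<in>?d ` M. a m * ?v m)"
  proof (intro sum.cong refl)
    fix m
    have "(\<Sum>l\<in>N m. c l * ?v l) = (\<Sum>l\<in>N m. c l * (?v m * ?v (?j l)))"
      using N_eq by (intro sum.cong refl) (metis monomial_value_simps(2))
    then show "(\<Sum>l\<in>N m. c l * ?v l) = a m * ?v m"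
      unfolding a_def by (simp add: sum_distrib_left mult_ac)
  qed
  finally have sum0: "(\<Sum>m\<in>?d ` M. a m * ?v m) = 0" by simp
  have a0: "a m = 0" if "m \<in> ?d ` M" for m
    by (rule algebraically_independentD[OF indD _ _ _ sum0 that]) (use * aR in auto)
  show "\<forall>m\<in>M. c m = 0"
  proof
    fix l assume l: "l \<in> M"
    then have mem: "?j l \<in> ?j ` N (?d l)" by (auto simp: N_def)
    have sum0': "(\<Sum>k\<in>?j ` N (?d l). c (?d l + k) * ?v k) = 0"
      using a0[of "?d l"] l by (simp add: a_eq)
    have "c (?d l + ?j l) = 0"
      by (rule algebraically_independentD[OF indJ, where c = "\<lambda>k. c (?d l + k)", OF _ _ _ sum0' mem])
        (use finN k in blast)+
    then show "c l = 0" using part[of l] by simp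
  qed
qed

lemma algebraically_independent_invert:
  assumes S: "subring S" and ind: "algebraically_independent S D x"
    and A: "\<And>f. f \<in> D \<Longrightarrow> A f \<in> S \<and> A f \<noteq> 0" and B: "\<And>f. f \<in> D \<Longrightarrow> B f \<in> S \<and> B f \<noteq> 0"
  shows "algebraically_independent S D (\<lambda>f. A f / B f / x f)"
  unfolding algebraically_independent_def
proof (intro allI impI)
  let ?y = "\<lambda>f. A f / B f / x f"
  fix M c assume *: "finite M \<and> (\<forall>m\<in>M. set_mset m \<subseteq> D \<and> c m \<in> S) \<and>
    (\<Sum>m\<in>M. c m * monomial_value ?y m) = 0"
  \<comment> \<open>A common multiple of all monomials of the relation, so that \<open>N - m\<close>
    is an honest complement for every \<open>m\<close> in \<open>M\<close>.\<close>
  define N where "N = \<Sum>M"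
  have sub: "m \<subseteq># N" if "m \<in> M" for m
    unfolding N_def using * that by (metis mset_subset_eq_add_left sum.remove)
  have ND: "set_mset N \<subseteq> D"
    using * by (auto simp: N_def set_mset_sum)
  have x0: "x f \<noteq> 0" if "f \<in> D" for f
    using algebraically_independent_nonzero[OF ind] S that by (auto simp: subring_def)
  have clear: "monomial_value (\<lambda>f. B f * x f) N * monomial_value ?y m =
      monomial_value A m * monomial_value B (N - m) * monomial_value x (N - m)" if m: "m \<in> M" for m
  proof -
    have "monomial_value (\<lambda>f. B f * x f) N =
        monomial_value (\<lambda>f. B f * x f) m * monomial_value (\<lambda>f. B f * x f) (N - m)"
      using sub[OF m] by (metis monomial_value_simps(2) subset_mset.add_diff_inverse)
    moreover have "monomial_value A m = monomial_value (\<lambda>f. B f * x f * ?y f) m"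
      using * m B x0 by (intro monomial_value_cong) (auto simp: subset_iff)
    ultimately show ?thesis by (simp only: monomial_value_mult mult_ac)
  qed
  \<comment> \<open>Coefficient of the cleared relation at the exponent \<open>k = N - m\<close>.
    Besides \<open>c m\<close> it contains a product of values of \<open>A\<close> and
    \<open>B\<close>, which is nonzero and is cancelled at the end.\<close>
  define a where "a k = c (N - k) * (monomial_value A (N - k) * monomial_value B k)" for k
  \<comment> \<open>Complementation in \<open>N\<close> is its own inverse on \<open>M\<close>, so
    clearing denominators does not merge terms.\<close>
  have NN: "N - (N - m) = m" if "m \<in> M" for m
    using sub[OF that] by (intro multiset_eqI) (simp add: mset_subset_eq_count)
  have inj: "inj_on (\<lambda>m. N - m) M" using NN by (metis inj_onI)
  have "0 = monomial_value (\<lambda>f. B f * x f) N * (\<Sum>m\<in>M. c m * monomial_value ?y m)"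
    using * by simp
  also have "\<dots> = (\<Sum>m\<in>M. a (N - m) * monomial_value x (N - m))"
    unfolding sum_distrib_left
  proof (intro sum.cong refl)
    fix m assume m: "m \<in> M"
    show "monomial_value (\<lambda>f. B f * x f) N * (c m * monomial_value ?y m) =
        a (N - m) * monomial_value x (N - m)"
      using clear[OF m] by (simp only: a_def NN[OF m] mult_ac)
  qed
  also have "\<dots> = (\<Sum>k\<in>(\<lambda>m. N - m) ` M. a k * monomial_value x k)"
    by (simp add: sum.reindex[OF inj])
  finally have sum0: "(\<Sum>k\<in>(\<lambda>m. N - m) ` M. a k * monomial_value x k) = 0" by simp
  have mono: "monomial_value z m \<in> S" if "set_mset m \<subseteq> D" "\<And>f. f \<in> D \<Longrightarrow> z f \<in> S" for z m
    using that(1) by (induction m) (use S that(2) in \<open>auto simp: subring_def\<close>)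
  have ND': "set_mset (N - m) \<subseteq> D" for m
    using ND by (meson in_diffD subset_iff)
  have aS: "a k \<in> S" if k: "k \<in> (\<lambda>m. N - m) ` M" for k
  proof -
    obtain m where m: "m \<in> M" "k = N - m" using k by auto
    have "monomial_value A m \<in> S" "monomial_value B k \<in> S" "c m \<in> S"
      using mono * m A B ND' by auto
    then show ?thesis using S m by (simp add: a_def NN subring_def)
  qed
  have "a (N - m) = 0" if "m \<in> M" for m
    using algebraically_independentD[OF ind _ _ aS sum0, of "N - m"] * ND' that by auto
  moreover have "monomial_value A m * monomial_value B (N - m) \<noteq> 0" if "m \<in> M" for m
    using that A B * ND' by (auto intro!: monomial_value_nonzero simp: subset_iff)
  ultimately show "\<forall>m\<in>M. c m = 0"
    using NN by (auto simp: a_def)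
qed

subsection \<open>Iterated boundaries and the lexicographic order\<close>

text \<open>The deleted positions are those whose entries are missing from the result. Hence the sum
  defining a coefficient of an iterated boundary has at most one term.\<close>

lemma nths_inj:
  assumes "distinct a" "I \<subseteq> {..<length a}" "J \<subseteq> {..<length a}" "nths a (- I) = nths a (- J)"
  shows "I = J"
proof -
  have *: "I = {i \<in> {..<length a}. a ! i \<notin> set (nths a (- I))}"
    if "I \<subseteq> {..<length a}" for I
    using that assms(1) by (auto simp: set_nths nth_eq_iff_index_eq)
  have "I = {i \<in> {..<length a}. a ! i \<notin> set (nths a (- J))}"
    unfolding assms(4)[symmetric] by (rule *[OF assms(2)])
  also have "\<dots> = J" by (rule *[OF assms(3), symmetric])
  finally show ?thesis .
qed

lemma abs_iter_boundary_le:
  assumes "distinct a"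
  shows "\<bar>iter_boundary k a e\<bar> \<le> 1"
proof -
  let ?S = "{I. I \<subseteq> {..<length a} \<and> card I = k \<and> nths a (- I) = e}"
  have "?S = {} \<or> (\<exists>I. ?S = {I})"
    using nths_inj[OF assms] by blast
  then show ?thesis
  proof
    assume "\<exists>I. ?S = {I}"
    then obtain I where "?S = {I}" ..
    then show ?thesis unfolding iter_boundary_def by simp
  qed (simp only: iter_boundary_def, simp)
qed

text \<open>The incidence number of a facet, through which the cycle condition is evaluated: the
  deleted vertex stands at index \<open>length xs\<close>.\<close>

lemma iter_boundary_remove1:
  assumes "distinct (xs @ v # ys)"
  shows "iter_boundary 1 (xs @ v # ys) (xs @ ys) = (-1) ^ length xs"
proof -
  let ?a = "xs @ v # ys" and ?p = "{length xs}"
  have "nths xs (- ?p) = xs" by (rule nths_all) auto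
  moreover have "nths ys {j. Suc (j + length xs) \<in> - ?p} = ys" by (rule nths_all) auto
  ultimately have p: "nths ?a (- ?p) = xs @ ys"
    by (simp add: nths_append nths_Cons)
  have "{I. I \<subseteq> {..<length ?a} \<and> card I = 1 \<and> nths ?a (- I) = xs @ ys} = {?p}" (is "?S = _")
  proof
    show "?S \<subseteq> {?p}"
    proof
      fix I assume "I \<in> ?S"
      then have "I = ?p" using p by (intro nths_inj[OF assms]) auto
      then show "I \<in> {?p}" by simp
    qed
    show "{?p} \<subseteq> ?S" using p by simp
  qed
  then show ?thesis unfolding iter_boundary_def by simp
qed

lemma iter_boundary_zero:
  assumes "\<not> set e \<subseteq> set a"
  shows "iter_boundary k a e = 0"
proof -
  have "{I. I \<subseteq> {..<length a} \<and> card I = k \<and> nths a (- I) = e} = {}"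
    using assms set_nths_subset[of a] by blast
  then show ?thesis by (simp only: iter_boundary_def sum.empty)
qed

lemma nths_rev:
  "nths (rev a) A = rev (nths a {i. i < length a \<and> length a - Suc i \<in> A})"
proof (induction a arbitrary: A)
  case (Cons x a)
  have "{j. Suc j < Suc (length a) \<and> length a - Suc j \<in> A} = {i. i < length a \<and> length a - Suc i \<in> A}"
    by auto
  then show ?case
    by (simp add: nths_append nths_Cons Cons.IH)
qed simp

lemma iter_boundary_map:
  assumes "inj_on s (set a \<union> set e)"
  shows "iter_boundary k (map s a) (map s e) = iter_boundary k a e"
proof -
  have "map s (nths a I) = map s e \<longleftrightarrow> nths a I = e" for I
    using assms set_nths_subset[of a I] by (intro inj_on_map_eq_map) (rule inj_on_subset, auto)
  then show ?thesis by (simp add: iter_boundary_def nths_map)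
qed

text \<open>Reversing the vertices replaces the index \<open>i\<close> by \<open>length a - 1 - i\<close>, of the same
  parity.\<close>

lemma iter_boundary_rev:
  assumes "odd (length a)"
  shows "iter_boundary k (rev a) (rev e) = iter_boundary k a e"
proof -
  let ?n = "length a"
  let ?r = "\<lambda>i. ?n - Suc i"
  let ?S = "{I. I \<subseteq> {..<?n} \<and> card I = k \<and> nths a (- I) = e}"
  let ?S' = "{I. I \<subseteq> {..<?n} \<and> card I = k \<and> nths (rev a) (- I) = rev e}"
  have rr: "?r ` ?r ` I = I" if "I \<subseteq> {..<?n}" for I
    using that by (force simp: image_image subset_iff)
  have inj: "inj_on ?r I" if "I \<subseteq> {..<?n}" for I
  proof (rule inj_onI)
    fix i j assume "i \<in> I" "j \<in> I" "?r i = ?r j"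
    moreover from this have "i < ?n" "j < ?n" using that by auto
    ultimately show "i = j" by arith
  qed
  have nths: "nths (rev a) (- ?r ` I) = rev (nths a (- I))" if I: "I \<subseteq> {..<?n}" for I
  proof -
    have mem: "(i < ?n \<and> ?r i \<in> - ?r ` I) = (i \<in> - I)" if "i < ?n" for i
    proof -
      have "inj_on ?r {..<?n}" by (rule inj) simp
      then show ?thesis using inj_on_image_mem_iff[of ?r "{..<?n}" i I] I that by auto
    qed
    have "nths a {i. i < ?n \<and> ?r i \<in> - ?r ` I} = nths a (- I)"
      unfolding nths_def
    proof (intro arg_cong[where f = "map fst"] filter_cong refl)
      fix p assume "p \<in> set (zip a [0..<?n])"
      then have "snd p < ?n" by (auto simp: set_zip)
      then show "(snd p \<in> {i. i < ?n \<and> ?r i \<in> - ?r ` I}) = (snd p \<in> - I)"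
        using mem[of "snd p"] by simp
    qed
    then show ?thesis unfolding nths_rev by simp
  qed
  have "(\<Sum>I\<in>?S. (-1) ^ \<Sum>I) = (\<Sum>I\<in>?S'. (-1::int) ^ \<Sum>I)"
  proof (rule sum.reindex_bij_witness[of _ "(`) ?r" "(`) ?r"])
    fix I assume I: "I \<in> ?S"
    then show "?r ` ?r ` I = I" using rr by blast
    show "?r ` I \<in> ?S'"
      using I nths[of I] inj[of I] by (auto simp: card_image)
    have "even (\<Sum>(?r ` I)) = even (\<Sum>I)"
    proof -
      have "\<Sum>(?r ` I) + \<Sum>I = (\<Sum>i\<in>I. ?r i + i)"
        using I inj[of I] by (simp add: sum.reindex sum.distrib)
      also have "\<dots> = (\<Sum>i\<in>I. ?n - 1)"
        using I by (intro sum.cong) auto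
      also have "even \<dots>" using assms by simp
      finally show ?thesis by presburger
    qed
    then show "(-1::int) ^ \<Sum>(?r ` I) = (-1) ^ \<Sum>I"
      by (simp add: minus_one_power_iff)
  next
    fix I assume I: "I \<in> ?S'"
    then show r: "?r ` ?r ` I = I" using rr by blast
    have sub: "?r ` I \<subseteq> {..<?n}" using I assms by (auto simp: odd_pos)
    have "rev (nths a (- ?r ` I)) = rev e"
      using nths[OF sub] r I by simp
    then show "?r ` I \<in> ?S"
      using I sub inj[of I] by (auto simp: card_image)
  qed
  then show ?thesis unfolding iter_boundary_def by simp
qed

section \<open>Order-reversing maps and the order of facets\<close>

lemma sorted_list_of_set_image_antimono:
  fixes s :: "nat \<Rightarrow> nat"
  assumes "finite A" and anti: "\<And>x y. x \<in> A \<Longrightarrow> y \<in> A \<Longrightarrow> x < y \<Longrightarrow> s y < s x"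
  shows "sorted_list_of_set (s ` A) = map s (rev (sorted_list_of_set A))"
proof (rule sorted_distinct_set_unique)
  have inj: "inj_on s A"
    using anti by (intro linorder_inj_onI') force
  then show "distinct (map s (rev (sorted_list_of_set A)))"
    using assms(1) by (simp add: distinct_map)
  have "sorted_wrt (\<lambda>x y. s y \<le> s x) (sorted_list_of_set A)"
    using strict_sorted_list_of_set[of A]
    by (rule sorted_wrt_mono_rel[rotated]) (use anti assms(1) in \<open>auto intro: less_imp_le\<close>)
  then show "sorted (map s (rev (sorted_list_of_set A)))"
    by (simp add: sorted_wrt_map sorted_wrt_rev)
qed (use assms(1) in auto)

lemma sorted_list_of_set_Un:
  fixes A B :: "nat set"
  assumes "finite A" "finite B" "\<And>x y. x \<in> A \<Longrightarrow> y \<in> B \<Longrightarrow> x < y"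
  shows "sorted_list_of_set (A \<union> B) = sorted_list_of_set A @ sorted_list_of_set B"
  using assms by (intro sorted_distinct_set_unique) (auto simp: sorted_append less_imp_le)

text \<open>The two sorted lists agree on the elements of \<open>C\<close> below \<open>x\<close>.
  Then one continues with \<open>x\<close>, the other with the least element of \<open>y\<close> and
  the elements of \<open>C\<close> above \<open>x\<close>, which is larger than
  \<open>x\<close>.\<close>

lemma simplex_less_insertI:
  assumes "finite C" "x \<notin> C" "y \<notin> C" "x < y"
  shows "simplex_less (insert x C) (insert y C)"
proof -
  let ?A = "{c \<in> C. c < x}" and ?B = "{c \<in> C. x < c}"
  have fin: "finite ?A" "finite ?B" using assms(1) by auto
  have neq: "c < x \<or> x < c" if "c \<in> C" for c
    using assms(2) that by (metis neq_iff)
  then have "insert x C = ?A \<union> ({x} \<union> ?B)" by auto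
  moreover have "sorted_list_of_set (?A \<union> ({x} \<union> ?B)) = sorted_list_of_set ?A @ sorted_list_of_set ({x} \<union> ?B)"
    using fin by (intro sorted_list_of_set_Un) auto
  moreover have "sorted_list_of_set ({x} \<union> ?B) = sorted_list_of_set {x} @ sorted_list_of_set ?B"
    using fin by (intro sorted_list_of_set_Un) auto
  ultimately have x: "sorted_list_of_set (insert x C) = sorted_list_of_set ?A @ x # sorted_list_of_set ?B"
    by simp
  have "insert y C = ?A \<union> insert y ?B" using neq by auto
  moreover have "sorted_list_of_set (?A \<union> insert y ?B) = sorted_list_of_set ?A @ sorted_list_of_set (insert y ?B)"
    using fin assms(4) by (intro sorted_list_of_set_Un) auto
  ultimately have y: "sorted_list_of_set (insert y C) = sorted_list_of_set ?A @ sorted_list_of_set (insert y ?B)"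
    by simp
  obtain v vs where v: "sorted_list_of_set (insert y ?B) = v # vs"
    using fin by (metis finite_insert insert_not_empty list.exhaust sorted_list_of_set_eq_Nil_iff)
  have "v \<in> insert y ?B"
    using v fin by (metis finite_insert list.set_intros(1) set_sorted_list_of_set)
  then have "x < v" using assms(4) by auto
  then show ?thesis
    unfolding simplex_less_def x y v by (simp add: lexord_append_left_rightI)
qed

lemma simplex_less_irrefl: "\<not> simplex_less f f"
  by (simp add: simplex_less_def lexord_irreflexive)

lemma simplex_less_asym: "simplex_less f g \<Longrightarrow> \<not> simplex_less g f"
  unfolding simplex_less_def by (rule lexord_asymmetric) (auto intro: asymI)

lemma simplex_less_insert:
  assumes "finite C" "x \<notin> C" "y \<notin> C"
  shows "simplex_less (insert x C) (insert y C) \<longleftrightarrow> x < y"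
  using simplex_less_insertI[OF assms] simplex_less_insertI[OF assms(1,3,2)]
    simplex_less_irrefl simplex_less_asym by (metis linorder_less_linear)

text \<open>Two facets of a simplex differ in one vertex, which is why an order-reversing map
  reverses their lexicographic order.\<close>

lemma simplex_less_antimono:
  fixes s :: "nat \<Rightarrow> nat"
  assumes F: "finite F" "f \<subseteq> F" "g \<subseteq> F" "card F = Suc n" "card f = n" "card g = n"
    and anti: "\<And>x y. x \<in> F \<Longrightarrow> y \<in> F \<Longrightarrow> x < y \<Longrightarrow> s y < s x"
  shows "simplex_less (s ` f) (s ` g) \<longleftrightarrow> simplex_less g f"
proof (cases "f = g")
  case False
  have "finite f" "finite g" using F finite_subset by auto
  have "card (F - f) = 1" "card (F - g) = 1"
    using F \<open>finite f\<close> \<open>finite g\<close> by (simp_all add: card_Diff_subset)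
  then obtain y x where "F - f = {y}" "F - g = {x}" by (auto simp: card_1_singleton_iff)
  define C where "C = f \<inter> g"
  have "x \<noteq> y"
    using False F(2,3) \<open>F - f = {y}\<close> \<open>F - g = {x}\<close> by (metis double_diff order_refl)
  have "x \<in> F - g" "y \<in> F - f" using \<open>F - f = {y}\<close> \<open>F - g = {x}\<close> by auto
  moreover have "x \<notin> F - f" "y \<notin> F - g"
    using \<open>F - f = {y}\<close> \<open>F - g = {x}\<close> \<open>x \<noteq> y\<close> by simp_all
  ultimately have "x \<in> f" "y \<in> g" "x \<notin> g" "y \<notin> f" by auto
  moreover have "u \<in> f \<longleftrightarrow> u = x \<or> u \<in> C" "u \<in> g \<longleftrightarrow> u = y \<or> u \<in> C" for u
  proof -
    have "u \<in> F \<Longrightarrow> u \<notin> f \<Longrightarrow> u = y" "u \<in> F \<Longrightarrow> u \<notin> g \<Longrightarrow> u = x"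
      using \<open>F - f = {y}\<close> \<open>F - g = {x}\<close> by (metis DiffI singletonD)+
    then show "u \<in> f \<longleftrightarrow> u = x \<or> u \<in> C" "u \<in> g \<longleftrightarrow> u = y \<or> u \<in> C"
      using F(2,3) \<open>x \<in> f\<close> \<open>y \<in> g\<close> unfolding C_def by auto
  qed
  then have "f = insert x C" "g = insert y C" by auto
  moreover have "insert y f = F"
  proof -
    have "f \<union> (F - f) = F" using F(2) by auto
    then show ?thesis unfolding \<open>F - f = {y}\<close> by simp
  qed
  moreover have "x \<notin> C" "y \<notin> C" using \<open>x \<notin> g\<close> \<open>y \<notin> f\<close> by (auto simp: C_def)
  ultimately have xy: "x \<noteq> y" "f = insert x C" "g = insert y C" "x \<notin> C" "y \<notin> C"
      "insert x (insert y C) = F"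
    using \<open>x \<noteq> y\<close> by (metis insert_commute)+
  have inj: "inj_on s F"
    using anti by (intro linorder_inj_onI') force
  have fin: "finite C" using \<open>finite f\<close> by (simp add: C_def)
  have s: "s x \<notin> s ` C" "s y \<notin> s ` C"
    using inj xy by (auto simp: inj_on_def)
  have "s x < s y \<longleftrightarrow> y < x"
    using anti[of x y] anti[of y x] xy(1,6) by (metis insertCI linorder_neqE_nat not_less_iff_gr_or_eq)
  then show ?thesis
    unfolding xy(2,3) image_insert
    using simplex_less_insert[OF _ s] simplex_less_insert[OF fin xy(5,4)] fin by simp
qed (simp add: simplex_less_irrefl)

section \<open>The matrix of a single simplex\<close>

lemma in_faces: "0 < n \<Longrightarrow> f \<in> faces n K \<longleftrightarrow> f \<in> K \<and> finite f \<and> card f = n"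
  by (auto simp: faces_def simplices_def)

lemma edge_coeff_commute: "edge_coeff n ori F f g = edge_coeff n ori F g f"
  by (simp add: edge_coeff_def Un_commute Int_commute)

text \<open>The sign comes from the order alone. The edge coefficient is symmetric in the two facets
  and invariant under \<open>s\<close>, because \<open>F\<close> has the odd number
  \<open>n + 1\<close> of vertices; but \<open>s\<close> interchanges which of the two facets is the
  smaller.\<close>

lemma simplex_matrix_antimono:
  fixes s :: "nat \<Rightarrow> nat"
  assumes n: "0 < n" "even n" and F: "F \<in> simplices n K"
    and anti: "\<And>x y. x \<in> F \<Longrightarrow> y \<in> F \<Longrightarrow> x < y \<Longrightarrow> s y < s x"
    and ori: "ori' (s ` F) = ori F" and fg: "f \<subseteq> F" "g \<subseteq> F"
  shows "simplex_matrix n ori' (s ` F) (s ` f) (s ` g) = - simplex_matrix n ori F f g"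
proof -
  have fin: "finite F" "card F = Suc n" using F by (auto simp: simplices_def)
  have inj: "inj_on s F"
    using anti by (intro linorder_inj_onI') force
  have sub: "inj_on s u" "finite u" "card (s ` u) = card u" if "u \<subseteq> F" for u
    using that inj_on_subset[OF inj] finite_subset fin(1) by (auto simp: card_image)
  have face: "s ` u \<in> faces n (Pow (s ` F)) \<longleftrightarrow> u \<in> faces n (Pow F)" if "u \<subseteq> F" for u
    using that sub[OF that] n by (auto simp: in_faces)
  have edge: "edge_coeff n ori' (s ` F) (s ` u) (s ` v) = edge_coeff n ori F u v"
    if "u \<subseteq> F" "v \<subseteq> F" for u v
  proof -
    let ?e = "(u \<union> v) - (u \<inter> v)"
    have e: "?e \<subseteq> F" using that by auto
    have im: "s ` u \<union> s ` v - s ` u \<inter> s ` v = s ` ?e"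
      using inj that by (auto simp: inj_on_def)
    have "sorted_list_of_set (s ` w) = map s (rev (sorted_list_of_set w))" if "w \<subseteq> F" for w
      using that sub(2)[OF that] anti by (intro sorted_list_of_set_image_antimono) blast+
    moreover have "iter_boundary (n - 1) (map s (rev (sorted_list_of_set F)))
        (map s (rev (sorted_list_of_set ?e))) =
      iter_boundary (n - 1) (sorted_list_of_set F) (sorted_list_of_set ?e)"
    proof (subst iter_boundary_map)
      show "inj_on s (set (rev (sorted_list_of_set F)) \<union> set (rev (sorted_list_of_set ?e)))"
        using e sub(2)[OF e] fin inj by (simp add: Un_absorb2)
      show "iter_boundary (n - 1) (rev (sorted_list_of_set F)) (rev (sorted_list_of_set ?e)) =
          iter_boundary (n - 1) (sorted_list_of_set F) (sorted_list_of_set ?e)"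
        using fin n by (intro iter_boundary_rev) simp
    qed
    ultimately show ?thesis
      unfolding edge_coeff_def im ori using e by simp
  qed
  show ?thesis
  proof (cases "f \<in> faces n (Pow F) \<and> g \<in> faces n (Pow F)")
    case True
    then have "card f = n" "card g = n" using n by (auto simp: in_faces)
    then have "simplex_less (s ` f) (s ` g) \<longleftrightarrow> simplex_less g f"
      "simplex_less (s ` g) (s ` f) \<longleftrightarrow> simplex_less f g"
      using simplex_less_antimono[OF fin(1) fg fin(2) _ _ anti]
        simplex_less_antimono[OF fin(1) fg(2,1) fin(2) _ _ anti] by auto
    then show ?thesis
      unfolding simplex_matrix_def face[OF fg(1)] face[OF fg(2)] edge[OF fg] edge[OF fg(2,1)]
      using simplex_less_asym[of f g] edge_coeff_commute[of n ori F f g] by simp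
  next
    case False
    then show ?thesis
      unfolding simplex_matrix_def face[OF fg(1)] face[OF fg(2)] by auto
  qed
qed

text \<open>Two different facets of a simplex span it, so at most one simplex contributes to each
  entry of the exchange matrix. This bounds the entries and decides whether an entry comes from
  inside or outside \<open>verts n\<close>.\<close>

lemma simplex_matrix_nonzero:
  assumes "0 < n" "F \<in> simplices n K" "simplex_matrix n ori F f g \<noteq> 0"
  shows "F = f \<union> g" "card f = n" "card g = n"
proof -
  have fg: "f \<noteq> g" "f \<in> faces n (Pow F)" "g \<in> faces n (Pow F)"
    using assms(3) by (auto simp: simplex_matrix_def simplex_less_irrefl split: if_splits)
  then show c: "card f = n" "card g = n" using assms(1) by (auto simp: in_faces)
  have F: "finite F" "card F = Suc n" "f \<union> g \<subseteq> F" "finite f" "finite g"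
    using assms fg by (auto simp: simplices_def in_faces)
  have "f \<subset> f \<union> g"
    using c F fg(1) by (metis Un_upper1 Un_upper2 card_subset_eq psubsetI)
  then have "n < card (f \<union> g)"
    using c F by (metis finite_UnI psubset_card_mono)
  then show "F = f \<union> g"
    using F by (metis Suc_leI card_seteq)
qed

lemma abs_simplex_matrix_le:
  assumes "\<bar>ori F\<bar> \<le> 1"
  shows "\<bar>simplex_matrix n ori F f g\<bar> \<le> 1"
proof -
  have "\<bar>edge_coeff n ori F u v\<bar> \<le> 1" for u v
    unfolding edge_coeff_def abs_mult
    using mult_mono[OF assms abs_iter_boundary_le] by simp
  then show ?thesis by (simp add: simplex_matrix_def)
qed

subsection \<open>Semifields\<close>

lemma semifield_right_inverse: "a * inverse a = (1::'p::semifield)"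
  using semifield_left_inverse[of a] by (simp only: mult.commute)

lemma semifield_inverse_eqI:
  fixes a b :: "'p::semifield"
  assumes "a * b = 1"
  shows "inverse a = b"
proof -
  have "inverse a = inverse a * (a * b)" using assms by simp
  also have "\<dots> = b" by (simp only: mult.assoc[symmetric] semifield_left_inverse mult_1_left)
  finally show ?thesis .
qed

lemma semifield_inverse_inverse: "inverse (inverse a) = (a::'p::semifield)"
  by (rule semifield_inverse_eqI) (rule semifield_left_inverse)

lemma semifield_inverse_divide: "inverse (a / b) = b / (a::'p::semifield)"
proof (rule semifield_inverse_eqI)
  have "a / b * (b / a) = (a * inverse a) * (b * inverse b)"
    by (simp only: semifield_divide mult_ac)
  then show "a / b * (b / a) = 1" by (simp only: semifield_right_inverse mult_1_left)
qed

lemma normalized_pair_sum: "fst (normalized_pair u) + snd (normalized_pair u) = 1"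
  and normalized_pair_divide: "fst (normalized_pair u) / snd (normalized_pair u) = u"
  using theI'[OF normalized_pair_unique[of u]] unfolding normalized_pair_def by auto

lemma normalized_pair_eqI:
  assumes "p + q = 1" "p / q = u"
  shows "normalized_pair u = (p, q)"
  unfolding normalized_pair_def
  by (rule the1_equality[OF normalized_pair_unique]) (simp add: assms)

subsection \<open>The symmetry of a bistellar pair\<close>

text \<open>The vertices of \<open>\<alpha> \<union> \<beta>\<close> in the normalized
  labelling.\<close>

definition verts :: "nat \<Rightarrow> nat set" where
  "verts n = {1..n + 2}"

lemma finite_verts [simp]: "finite (verts n)" and card_verts [simp]: "card (verts n) = n + 2"
  by (auto simp: verts_def)

text \<open>Truncated subtraction sends all labels from \<open>n + 3\<close> on to 0; restricting to
  \<open>verts n\<close> avoids this.\<close>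

lemma sig_sig: "f \<subseteq> verts n \<Longrightarrow> sig n (sig n f) = f"
  unfolding sig_def verts_def image_image by (force simp: subset_iff)

lemma sig_subset: "f \<subseteq> verts n \<Longrightarrow> sig n f \<subseteq> verts n"
  by (auto simp: sig_def verts_def subset_iff)

lemma sig_mono: "f \<subseteq> g \<Longrightarrow> sig n f \<subseteq> sig n g"
  by (auto simp: sig_def)

lemma card_sig: "f \<subseteq> verts n \<Longrightarrow> card (sig n f) = card f"
proof -
  assume "f \<subseteq> verts n"
  then have "inj_on (\<lambda>i. n + 3 - i) f" by (intro inj_onI) (auto simp: verts_def subset_iff; force)
  then show ?thesis unfolding sig_def by (rule card_image)
qed

lemma sig_Un: "sig n (f \<union> g) = sig n f \<union> sig n g"
  by (simp add: sig_def image_Un)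

text \<open>Replaces the join by a condition on subsets of \<open>\<alpha> \<union> \<beta>\<close>,
  on which the reversal acts simply by exchanging \<open>\<alpha>\<close> and
  \<open>\<beta>\<close>.\<close>

lemma Lam_iff:
  assumes "\<alpha> \<inter> \<beta> = {}"
  shows "f \<in> Lam \<alpha> \<beta> \<longleftrightarrow> f \<subseteq> \<alpha> \<union> \<beta> \<and> \<not> \<beta> \<subseteq> f"
proof
  assume "f \<in> Lam \<alpha> \<beta>"
  then show "f \<subseteq> \<alpha> \<union> \<beta> \<and> \<not> \<beta> \<subseteq> f"
    using assms unfolding Lam_def join_def bdry_def by blast
next
  assume f: "f \<subseteq> \<alpha> \<union> \<beta> \<and> \<not> \<beta> \<subseteq> f"
  then have "f = (f \<inter> \<alpha>) \<union> (f \<inter> \<beta>)" "f \<inter> \<alpha> \<in> Pow \<alpha>" "f \<inter> \<beta> \<in> bdry \<beta>"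
    by (auto simp: bdry_def)
  then show "f \<in> Lam \<alpha> \<beta>" unfolding Lam_def join_def by blast
qed

text \<open>The hypotheses are invariant under exchanging \<open>(K, \<alpha>)\<close> with \<open>(L, \<beta>)\<close>, so every
  consequence is available for both seed mutations.\<close>

locale bistellar_flip =
  fixes n :: nat and K L :: "nat set set" and \<alpha> \<beta> :: "nat set" and ori ori' :: "nat set \<Rightarrow> int"
  assumes n: "0 < n" "even n"
    and verts: "\<alpha> \<union> \<beta> = verts n" "\<alpha> \<inter> \<beta> = {}" and sig: "sig n \<alpha> = \<beta>" "sig n \<beta> = \<alpha>"
    and finite: "finite K" "finite L"
    and down: "\<And>s t. s \<in> K \<Longrightarrow> t \<subseteq> s \<Longrightarrow> t \<in> K" "\<And>s t. s \<in> L \<Longrightarrow> t \<subseteq> s \<Longrightarrow> t \<in> L"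
    and inside: "K \<inter> Pow (verts n) = Lam \<alpha> \<beta>" "L \<inter> Pow (verts n) = Lam \<beta> \<alpha>"
    and outside: "K - Pow (verts n) = L - Pow (verts n)"
    and ori_le: "\<And>F. F \<in> simplices n K \<Longrightarrow> \<bar>ori F\<bar> \<le> 1" "\<And>F. F \<in> simplices n L \<Longrightarrow> \<bar>ori' F\<bar> \<le> 1"
    and ori_outside: "\<And>F. F \<in> K - Pow (verts n) \<Longrightarrow> ori' F = ori F"
    and ori_sig: "\<And>F. F \<in> simplices n (Lam \<alpha> \<beta>) \<Longrightarrow> ori' (sig n F) = ori F"
begin

lemma Lam_eq: "f \<in> Lam \<alpha> \<beta> \<longleftrightarrow> f \<subseteq> verts n \<and> \<not> \<beta> \<subseteq> f" "f \<in> Lam \<beta> \<alpha> \<longleftrightarrow> f \<subseteq> verts n \<and> \<not> \<alpha> \<subseteq> f"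
  using Lam_iff[of \<alpha> \<beta> f] Lam_iff[of \<beta> \<alpha> f] verts by (auto simp: Un_commute Int_commute)

lemma subset_sig: "f \<subseteq> verts n \<Longrightarrow> \<alpha> \<subseteq> sig n f \<longleftrightarrow> \<beta> \<subseteq> f" "f \<subseteq> verts n \<Longrightarrow> \<beta> \<subseteq> sig n f \<longleftrightarrow> \<alpha> \<subseteq> f"
  using sig_mono[of \<alpha> f n] sig_mono[of \<beta> f n] sig_mono[of \<alpha> "sig n f" n] sig_mono[of \<beta> "sig n f" n]
    sig sig_sig by auto

lemma faces_Lam:
  "f \<in> faces n (Lam \<alpha> \<beta>) \<longleftrightarrow> f \<subseteq> verts n \<and> card f = n \<and> \<not> \<beta> \<subseteq> f"
  "f \<in> faces n (Lam \<beta> \<alpha>) \<longleftrightarrow> f \<subseteq> verts n \<and> card f = n \<and> \<not> \<alpha> \<subseteq> f"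
  using n finite_subset[of f "verts n"] by (auto simp: in_faces Lam_eq)

lemma simplices_Lam:
  "F \<in> simplices n (Lam \<alpha> \<beta>) \<longleftrightarrow> F \<subseteq> verts n \<and> card F = n + 1 \<and> \<not> \<beta> \<subseteq> F"
  "F \<in> simplices n (Lam \<beta> \<alpha>) \<longleftrightarrow> F \<subseteq> verts n \<and> card F = n + 1 \<and> \<not> \<alpha> \<subseteq> F"
  using finite_subset[of F "verts n"] by (auto simp: simplices_def Lam_eq)

lemma flip_sym: "bistellar_flip n L K \<beta> \<alpha> ori' ori"
proof
  fix F assume "F \<in> simplices n (Lam \<beta> \<alpha>)"
  then have "sig n F \<in> simplices n (Lam \<alpha> \<beta>)" "sig n (sig n F) = F"
    by (auto simp: simplices_Lam sig_subset card_sig subset_sig sig_sig)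
  then show "ori (sig n F) = ori' F" using ori_sig by metis
next
  fix F assume "F \<in> L - Pow (verts n)"
  then show "ori F = ori' F" using ori_outside outside by auto
qed (use n verts sig finite inside outside ori_le in \<open>auto intro: down\<close>)

lemma bm_eq: "bm K \<alpha> \<beta> = L"
proof -
  have "bm K \<alpha> \<beta> = (K - Pow (verts n)) \<union> (L \<inter> Pow (verts n))"
    unfolding bm_def inside[symmetric] by blast
  then show ?thesis unfolding outside by blast
qed

lemma in_Dset:
  "f \<in> Dset n \<alpha> \<beta> \<longleftrightarrow> f \<subseteq> verts n \<and> card f = n \<and> \<not> \<beta> \<subseteq> f \<and> \<alpha> \<subseteq> f"
  "f \<in> Dset n \<beta> \<alpha> \<longleftrightarrow> f \<subseteq> verts n \<and> card f = n \<and> \<not> \<alpha> \<subseteq> f \<and> \<beta> \<subseteq> f"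
  unfolding Dset_def Diff_iff faces_Lam by blast+

lemma sig_Dset: "f \<in> Dset n \<alpha> \<beta> \<Longrightarrow> sig n f \<in> Dset n \<beta> \<alpha>"
  by (simp add: in_Dset sig_subset card_sig subset_sig)

lemma sig_faces_Lam: "f \<in> faces n (Lam \<alpha> \<beta>) \<Longrightarrow> sig n f \<in> faces n (Lam \<beta> \<alpha>)"
  by (simp add: faces_Lam sig_subset card_sig subset_sig)

text \<open>A form of \<open>faces n (Lam \<alpha> \<beta>) - Dset n \<alpha> \<beta>\<close> that
  treats \<open>\<alpha>\<close> and \<open>\<beta>\<close> alike, so that the exchange monomials of
  both mutations range over one and the same set.\<close>

definition common :: "nat set set" where
  "common = {f. f \<subseteq> verts n \<and> card f = n \<and> \<not> \<alpha> \<subseteq> f \<and> \<not> \<beta> \<subseteq> f}"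

lemma common_eq:
  "faces n (Lam \<alpha> \<beta>) - Dset n \<alpha> \<beta> = common" "faces n (Lam \<beta> \<alpha>) - Dset n \<beta> \<alpha> = common"
  unfolding set_eq_iff Diff_iff common_def mem_Collect_eq faces_Lam in_Dset by blast+

lemma sig_common: "f \<in> common \<Longrightarrow> sig n f \<in> common" and sig_sig_common: "f \<in> common \<Longrightarrow> sig n (sig n f) = f"
  by (simp_all add: common_def sig_subset card_sig subset_sig sig_sig)

lemma sig_sig_Dset: "f \<in> Dset n \<alpha> \<beta> \<Longrightarrow> sig n (sig n f) = f" "f \<in> Dset n \<beta> \<alpha> \<Longrightarrow> sig n (sig n f) = f"
  by (simp_all add: in_Dset sig_sig)

lemma finite_common: "finite common"
  by (rule finite_subset[of _ "Pow (verts n)"]) (auto simp: common_def)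

lemma faces_inside: "f \<subseteq> verts n \<Longrightarrow> f \<in> faces n K \<longleftrightarrow> f \<in> faces n (Lam \<alpha> \<beta>)"
  using n inside(1) by (auto simp: in_faces)

lemma faces_outside: "\<not> f \<subseteq> verts n \<Longrightarrow> f \<in> faces n K \<longleftrightarrow> f \<in> faces n L"
  using n outside by (auto simp: in_faces)

lemma Dset_subset: "Dset n \<alpha> \<beta> \<subseteq> faces n K"
proof
  fix f assume "f \<in> Dset n \<alpha> \<beta>"
  then have "f \<in> faces n (Lam \<alpha> \<beta>)" "f \<subseteq> verts n"
    unfolding in_Dset faces_Lam by simp_all
  then show "f \<in> faces n K" using faces_inside by blast
qed

lemma common_subset: "common \<subseteq> faces n K - Dset n \<alpha> \<beta>"
proof
  fix f assume f: "f \<in> common"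
  then have "f \<in> faces n (Lam \<alpha> \<beta>)" "f \<subseteq> verts n"
    unfolding common_def faces_Lam by simp_all
  then show "f \<in> faces n K - Dset n \<alpha> \<beta>"
    using f faces_inside common_eq(1) by blast
qed

end

section \<open>Facets and exchange matrices of the two complexes\<close>

context bistellar_flip
begin

text \<open>Supplies the mirror images of the facts proved so far. It is renewed in each later
  context so that newer facts have mirror images too.\<close>

interpretation swap: bistellar_flip n L K \<beta> \<alpha> ori' ori by (rule flip_sym)

text \<open>These are the indices of the variables shared by both clusters: \<open>common\<close>
  together with the facets that leave \<open>verts n\<close>.\<close>

lemma faces_minus_Dset: "faces n K - Dset n \<alpha> \<beta> = faces n L - Dset n \<beta> \<alpha>"
proof (rule set_eqI)
  fix f show "f \<in> faces n K - Dset n \<alpha> \<beta> \<longleftrightarrow> f \<in> faces n L - Dset n \<beta> \<alpha>"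
  proof (cases "f \<subseteq> verts n")
    case True
    then show ?thesis
      unfolding Diff_iff using faces_inside swap.faces_inside common_eq by blast
  next
    case False
    then show ?thesis using faces_outside by (simp add: in_Dset)
  qed
qed

lemma phi_in: "f \<in> faces n K \<Longrightarrow> phi n \<alpha> \<beta> f \<in> faces n L"
  and phi_phi: "f \<in> faces n K \<Longrightarrow> phi n \<beta> \<alpha> (phi n \<alpha> \<beta> f) = f"
proof -
  assume f: "f \<in> faces n K"
  have "phi n \<alpha> \<beta> f \<in> faces n L \<and> phi n \<beta> \<alpha> (phi n \<alpha> \<beta> f) = f"
  proof (cases "f \<subseteq> verts n")
    case True
    then have "f \<in> faces n (Lam \<alpha> \<beta>)" using f faces_inside by blast
    then show ?thesis
      using sig_faces_Lam[of f] swap.faces_inside[of "sig n f"] True sig_subset[OF True]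
      by (simp add: phi_def sig_sig)
  next
    case False
    then show ?thesis using f faces_outside by (simp add: phi_def faces_Lam)
  qed
  then show "phi n \<alpha> \<beta> f \<in> faces n L" "phi n \<beta> \<alpha> (phi n \<alpha> \<beta> f) = f" by auto
qed

lemma exchange_matrix_inside:
  assumes "f \<subseteq> verts n" "g \<subseteq> verts n"
  shows "exchange_matrix n K ori f g = (\<Sum>F\<in>simplices n (Lam \<alpha> \<beta>). simplex_matrix n ori F f g)"
  unfolding exchange_matrix_def
proof (rule sum.mono_neutral_right)
  show "finite (simplices n K)" using finite by (simp add: simplices_def)
  show "simplices n (Lam \<alpha> \<beta>) \<subseteq> simplices n K" using inside by (auto simp: simplices_def)
  show "\<forall>F\<in>simplices n K - simplices n (Lam \<alpha> \<beta>). simplex_matrix n ori F f g = 0"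
  proof (rule ballI, rule ccontr)
    fix F assume F: "F \<in> simplices n K - simplices n (Lam \<alpha> \<beta>)" "simplex_matrix n ori F f g \<noteq> 0"
    then have "F \<subseteq> verts n" using simplex_matrix_nonzero(1)[OF n(1), of F K ori f g] assms by blast
    then show False using F(1) inside(1) by (auto simp: simplices_def)
  qed
qed

lemma exchange_matrix_outside:
  assumes "\<not> (f \<subseteq> verts n \<and> g \<subseteq> verts n)"
  shows "exchange_matrix n K ori f g =
    (\<Sum>F\<in>simplices n (K - Pow (verts n)). simplex_matrix n ori F f g)"
  unfolding exchange_matrix_def
proof (rule sum.mono_neutral_right)
  show "finite (simplices n K)" using finite by (simp add: simplices_def)
  show "simplices n (K - Pow (verts n)) \<subseteq> simplices n K" by (auto simp: simplices_def)
  show "\<forall>F\<in>simplices n K - simplices n (K - Pow (verts n)). simplex_matrix n ori F f g = 0"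
  proof (rule ballI, rule ccontr)
    fix F assume F: "F \<in> simplices n K - simplices n (K - Pow (verts n))" "simplex_matrix n ori F f g \<noteq> 0"
    then have "\<not> F \<subseteq> verts n" using simplex_matrix_nonzero(1)[OF n(1), of F K ori f g] assms by blast
    then show False using F(1) by (auto simp: simplices_def)
  qed
qed

lemma exchange_matrix_zero:
  assumes "f \<notin> faces n K \<or> g \<notin> faces n K"
  shows "exchange_matrix n K ori f g = 0"
  unfolding exchange_matrix_def
proof (rule sum.neutral, rule ballI, rule ccontr)
  fix F assume F: "F \<in> simplices n K" and nz: "simplex_matrix n ori F f g \<noteq> 0"
  have "F = f \<union> g" "card f = n" "card g = n" using simplex_matrix_nonzero[OF n(1) F nz] by auto
  moreover have "F \<in> K" "finite F" using F by (auto simp: simplices_def)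
  ultimately show False using assms n(1) down(1)[of F f] down(1)[of F g] by (auto simp: in_faces)
qed

lemma abs_exchange_matrix_le: "\<bar>exchange_matrix n K ori f g\<bar> \<le> 1"
proof -
  let ?S = "simplices n K"
  have "exchange_matrix n K ori f g = (\<Sum>F\<in>?S \<inter> {f \<union> g}. simplex_matrix n ori F f g)"
    unfolding exchange_matrix_def
  proof (rule sum.mono_neutral_right)
    show "finite ?S" using finite by (simp add: simplices_def)
    show "\<forall>F\<in>?S - ?S \<inter> {f \<union> g}. simplex_matrix n ori F f g = 0"
      using simplex_matrix_nonzero(1)[OF n(1)] by blast
  qed simp
  also have "\<bar>\<dots>\<bar> \<le> 1"
    using abs_simplex_matrix_le[OF ori_le(1)] by (cases "f \<union> g \<in> ?S") auto
  finally show ?thesis .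
qed

end

context bistellar_flip
begin

interpretation swap: bistellar_flip n L K \<beta> \<alpha> ori' ori by (rule flip_sym)

lemma exchange_matrix_sig:
  assumes "f \<subseteq> verts n" "g \<subseteq> verts n"
  shows "exchange_matrix n L ori' (sig n f) (sig n g) = - exchange_matrix n K ori f g"
proof -
  have tm: "simplex_matrix n ori' (sig n F) (sig n f) (sig n g) = - simplex_matrix n ori F f g"
    if F: "F \<in> simplices n (Lam \<alpha> \<beta>)" for F
  proof (cases "f \<subseteq> F \<and> g \<subseteq> F")
    case True
    have "F \<subseteq> verts n" using F by (simp add: simplices_Lam)
    then show ?thesis
      using True ori_sig[OF F] unfolding sig_def
      by (intro simplex_matrix_antimono[OF n F]) (auto simp: verts_def subset_iff)
  next
    \<comment> \<open>Here both sides vanish. A nonzero mirrored entry would give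
      \<open>sig n F = sig n (f \<union> g)\<close>, and reversing once more
      \<open>F = f \<union> g\<close>, contrary to the case.\<close>
    case False
    have sF: "sig n F \<in> simplices n (Lam \<beta> \<alpha>)" "sig n (sig n F) = F"
      using F by (auto simp: simplices_Lam sig_subset card_sig subset_sig sig_sig)
    have "simplex_matrix n ori F f g = 0"
      using simplex_matrix_nonzero(1)[OF n(1) F] False by blast
    moreover have "simplex_matrix n ori' (sig n F) (sig n f) (sig n g) = 0"
    proof (rule ccontr)
      assume "simplex_matrix n ori' (sig n F) (sig n f) (sig n g) \<noteq> 0"
      then have "sig n F = sig n (f \<union> g)"
        using simplex_matrix_nonzero(1)[OF n(1) sF(1)] by (simp add: sig_Un)
      then have "sig n (sig n F) = sig n (sig n (f \<union> g))" by (rule arg_cong)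
      then have "F = f \<union> g" using sF(2) sig_sig[of "f \<union> g" n] assms by (simp only: Un_subset_iff)
      then show False using False by blast
    qed
    ultimately show ?thesis by simp
  qed
  have "(\<Sum>F\<in>simplices n (Lam \<beta> \<alpha>). simplex_matrix n ori' F (sig n f) (sig n g)) =
      (\<Sum>F\<in>simplices n (Lam \<alpha> \<beta>). - simplex_matrix n ori F f g)"
    by (rule sum.reindex_bij_witness[of _ "sig n" "sig n"])
      (auto simp: simplices_Lam sig_subset card_sig subset_sig sig_sig simp flip: tm)
  then show ?thesis
    using assms sig_subset
    by (simp add: exchange_matrix_inside swap.exchange_matrix_inside sum_negf)
qed

end

context bistellar_flip
begin

interpretation swap: bistellar_flip n L K \<beta> \<alpha> ori' ori by (rule flip_sym)

lemma mutate_exchange_matrix: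
  "mutate_matrix n K \<alpha> \<beta> (exchange_matrix n K ori) = exchange_matrix n L ori'"
proof (intro ext)
  fix f g
  let ?b = "exchange_matrix n K ori" and ?b' = "exchange_matrix n L ori'"
  consider "f \<notin> faces n L \<or> g \<notin> faces n L" | "f \<in> faces n L" "g \<in> faces n L" "f \<subseteq> verts n" "g \<subseteq> verts n"
    | "f \<in> faces n L" "g \<in> faces n L" "\<not> (f \<subseteq> verts n \<and> g \<subseteq> verts n)" by blast
  then show "mutate_matrix n K \<alpha> \<beta> ?b f g = ?b' f g"
  proof cases
    case 1
    then show ?thesis using swap.exchange_matrix_zero by (auto simp: mutate_matrix_def bm_eq)
  next
    case 2
    then have "?b' f g = - ?b (sig n f) (sig n g)"
      using swap.exchange_matrix_sig by simp
    then show ?thesis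
      using 2 swap.faces_inside by (simp add: mutate_matrix_def bm_eq)
  next
    case 3
    have "?b f g = ?b' f g"
      unfolding exchange_matrix_outside[OF 3(3)] swap.exchange_matrix_outside[OF 3(3)] outside[symmetric]
      by (intro sum.cong refl) (simp add: simplex_matrix_def edge_coeff_def simplices_def ori_outside)
    \<comment> \<open>If \<open>f\<close> or \<open>g\<close> is not a facet of \<open>K\<close>,
      the default 0 in \<open>mutate_matrix\<close> agrees with the entry of \<open>?b\<close>,
      which vanishes there.\<close>
    then show ?thesis
      using 3 exchange_matrix_zero[of f g] by (auto simp: mutate_matrix_def bm_eq faces_Lam)
  qed
qed

end

subsection \<open>Bistellar seed mutation\<close>

lemma monomial_value_in_polynomial_values:
  assumes "subring R" "set_mset m \<subseteq> J"
  shows "monomial_value x m \<in> polynomial_values R J x"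
  using combinations_term[of m "{m. set_mset m \<subseteq> J}" 1 R "monomial_value x"] assms
  by (simp add: subring_def)

lemma polynomial_values_cong:
  assumes "\<And>f. f \<in> J \<Longrightarrow> x f = y f"
  shows "polynomial_values R J x = polynomial_values R J y"
proof -
  have *: "polynomial_values R J x \<subseteq> polynomial_values R J y"
    if eq: "\<And>f. f \<in> J \<Longrightarrow> x f = y f" for x y
  proof
    fix a assume "a \<in> polynomial_values R J x"
    then obtain S c where S: "finite S" "S \<subseteq> {m. set_mset m \<subseteq> J}" "\<forall>m\<in>S. c m \<in> R"
        and a: "a = (\<Sum>m\<in>S. c m * monomial_value x m)"
      by (rule combinationsE)
    have "a = (\<Sum>m\<in>S. c m * monomial_value y m)"
      unfolding a
    proof (intro sum.cong refl arg_cong2[where f = "(*)"] monomial_value_cong)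
      fix m f assume "m \<in> S" "f \<in># m"
      then show "x f = y f" using S(2) eq by blast
    qed
    then show "a \<in> polynomial_values R J y"
      unfolding combinations_def using S by (intro CollectI exI[of _ S] exI[of _ c]) simp
  qed
  show ?thesis using *[of x y] *[of y x] assms by (simp add: subset_antisym)
qed

lemma in_seedsD:
  assumes "\<Sigma> \<in> seeds \<iota> n K ori"
  shows "cluster \<Sigma> \<in> extensional (faces n K)"
    "algebraically_independent (ZP \<iota>) (faces n K) (cluster \<Sigma>)"
    "pplus \<Sigma> \<in> extensional (faces n K)" "pminus \<Sigma> \<in> extensional (faces n K)"
    "\<And>f. f \<in> faces n K \<Longrightarrow> pplus \<Sigma> f + pminus \<Sigma> f = 1"
    "exmat \<Sigma> = exchange_matrix n K ori"
  using assms by (simp_all add: seeds_def)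

text \<open>Deliberately one-sided: that \<open>\<Sigma>'\<close> is a seed for \<open>L\<close> is
  among the conclusions, so inside this locale only the pair of complexes is mirrored, not the
  seed.\<close>

locale mutated_seed = bistellar_flip n K L \<alpha> \<beta> ori ori'
  for n K L \<alpha> \<beta> ori ori' +
  fixes \<iota> :: "'p::semifield \<Rightarrow> 'k::field" and \<Sigma> \<Sigma>' :: "('k, 'p) seed"
  assumes embedding: "group_ring_embedding \<iota>"
    and seed: "\<Sigma> \<in> seeds \<iota> n K ori"
    and seed'_def: "\<Sigma>' = seed_mutation \<iota> n K \<alpha> \<beta> \<Sigma>"
begin

interpretation swap: bistellar_flip n L K \<beta> \<alpha> ori' ori by (rule flip_sym)

abbreviation "b \<equiv> exchange_matrix n K ori"
abbreviation "b' \<equiv> exchange_matrix n L ori'"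

lemmas exmat = in_seedsD(6)[OF seed]

lemma exmat': "exmat \<Sigma>' = b'"
  by (simp add: seed'_def seed_mutation_def exmat mutate_exchange_matrix)

section \<open>Coefficients of the mutated seed\<close>

lemma coefficients':
  assumes "f \<in> faces n L"
  shows "pplus \<Sigma>' f = fst (normalized_pair (mutate_u n \<alpha> \<beta> \<Sigma> f))"
    "pminus \<Sigma>' f = snd (normalized_pair (mutate_u n \<alpha> \<beta> \<Sigma> f))"
  using assms by (simp_all add: seed'_def seed_mutation_def bm_eq)

lemma u_coeff': "f \<in> faces n L \<Longrightarrow> u_coeff \<Sigma>' f = mutate_u n \<alpha> \<beta> \<Sigma> f"
  unfolding u_coeff_def by (simp add: coefficients' normalized_pair_divide)

lemma normalized_u_coeff:
  assumes "f \<in> faces n K"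
  shows "normalized_pair (u_coeff \<Sigma> f) = (pplus \<Sigma> f, pminus \<Sigma> f)"
  using in_seedsD(5)[OF seed assms] by (intro normalized_pair_eqI) (simp_all add: u_coeff_def)

text \<open>The normalization is symmetric in the two coefficients, so the pair with inverted
  quotient is the pair in the opposite order.\<close>

lemma coefficients_Dset:
  assumes f: "f \<in> Dset n \<alpha> \<beta>"
  shows "pplus \<Sigma>' (sig n f) = pminus \<Sigma> f" "pminus \<Sigma>' (sig n f) = pplus \<Sigma> f"
proof -
  have fK: "f \<in> faces n K" and sL: "sig n f \<in> faces n L" and s: "sig n f \<in> Dset n \<beta> \<alpha>"
    using f Dset_subset swap.Dset_subset sig_Dset by auto
  have "mutate_u n \<alpha> \<beta> \<Sigma> (sig n f) = pminus \<Sigma> f / pplus \<Sigma> f"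
    using s by (simp add: mutate_u_def sig_sig_Dset(1)[OF f] u_coeff_def semifield_inverse_divide)
  moreover have "pminus \<Sigma> f + pplus \<Sigma> f = 1"
    using in_seedsD(5)[OF seed fK] by (simp only: add.commute)
  ultimately have "normalized_pair (mutate_u n \<alpha> \<beta> \<Sigma> (sig n f)) = (pminus \<Sigma> f, pplus \<Sigma> f)"
    by (intro normalized_pair_eqI) simp_all
  then show "pplus \<Sigma>' (sig n f) = pminus \<Sigma> f" "pminus \<Sigma>' (sig n f) = pplus \<Sigma> f"
    using sL by (simp_all add: coefficients')
qed

text \<open>On the facets in the product the two coefficients trade places while the matrix entries
  change sign. Hence numerator and denominator are interchanged in every factor.\<close>

lemma pi_coeff_inverse:
  assumes f: "f \<subseteq> verts n"
  shows "pi_coeff n \<beta> \<alpha> \<Sigma>' (sig n f) * pi_coeff n \<alpha> \<beta> \<Sigma> f = 1"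
proof -
  let ?p = "pplus \<Sigma>" and ?q = "pminus \<Sigma>"
  have "pi_coeff n \<beta> \<alpha> \<Sigma>' (sig n f) =
      (\<Prod>g\<in>Dset n \<alpha> \<beta>. ?q g ^ nat (- b g f) * inverse (?p g ^ nat (b g f)))"
    unfolding pi_coeff_def exmat'
  proof (rule prod.reindex_bij_witness[of _ "sig n" "sig n"])
    fix g assume g: "g \<in> Dset n \<beta> \<alpha>"
    show "sig n (sig n g) = g" by (rule sig_sig_Dset(2)[OF g])
    show s: "sig n g \<in> Dset n \<alpha> \<beta>" by (rule swap.sig_Dset[OF g])
    have "b' g (sig n f) = - b (sig n g) f"
      using exchange_matrix_sig[of "sig n g" f] f s sig_sig_Dset(2)[OF g] by (simp add: in_Dset)
    then show "?q (sig n g) ^ nat (- b (sig n g) f) * inverse (?p (sig n g) ^ nat (b (sig n g) f)) =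
        pplus \<Sigma>' g ^ nat (b' g (sig n f)) * inverse (pminus \<Sigma>' g ^ nat (- b' g (sig n f)))"
      using coefficients_Dset[OF s] sig_sig_Dset(2)[OF g] by simp
  next
    fix g assume g: "g \<in> Dset n \<alpha> \<beta>"
    show "sig n (sig n g) = g" by (rule sig_sig_Dset(1)[OF g])
    show "sig n g \<in> Dset n \<beta> \<alpha>" by (rule sig_Dset[OF g])
  qed
  moreover have "(y * inverse x) * (x * inverse y) = 1" for x y :: 'p
  proof -
    have "(y * inverse x) * (x * inverse y) = (x * inverse x) * (y * inverse y)"
      by (simp only: mult_ac)
    then show ?thesis by (simp only: semifield_right_inverse mult_1_left)
  qed
  ultimately show ?thesis
    unfolding pi_coeff_def exmat by (simp add: prod.distrib[symmetric])
qed

lemma mutate_u_involution: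
  assumes f: "f \<in> faces n K"
  shows "mutate_u n \<beta> \<alpha> \<Sigma>' f = u_coeff \<Sigma> f"
proof -
  consider "f \<in> Dset n \<alpha> \<beta>" | "f \<in> faces n (Lam \<alpha> \<beta>) - Dset n \<alpha> \<beta>" | "f \<notin> faces n (Lam \<alpha> \<beta>)"
    by blast
  then show ?thesis
  proof cases
    case 1
    then have "sig n f \<in> Dset n \<beta> \<alpha>" "sig n f \<in> faces n L"
      using sig_Dset swap.Dset_subset by auto
    then have "u_coeff \<Sigma>' (sig n f) = inverse (u_coeff \<Sigma> f)"
      using sig_sig_Dset(1)[OF 1] by (simp add: u_coeff' mutate_u_def)
    then show ?thesis using 1 by (simp add: mutate_u_def semifield_inverse_inverse)
  next
    case 2
    then have c: "f \<in> common" "sig n f \<in> common" using common_eq sig_common by blast+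
    then have s: "sig n f \<in> faces n (Lam \<beta> \<alpha>)" "sig n f \<notin> Dset n \<beta> \<alpha>" using common_eq(2) by blast+
    have sL: "sig n f \<in> faces n L" using c common_subset faces_minus_Dset by blast
    have "u_coeff \<Sigma>' (sig n f) = pi_coeff n \<alpha> \<beta> \<Sigma> f * u_coeff \<Sigma> f"
      using s sig_sig_common[OF c(1)] by (simp add: u_coeff'[OF sL] mutate_u_def)
    moreover have "f \<subseteq> verts n" using c by (simp add: common_def)
    ultimately have "pi_coeff n \<beta> \<alpha> \<Sigma>' (sig n f) * u_coeff \<Sigma>' (sig n f) = u_coeff \<Sigma> f"
      by (simp only: mult.assoc[symmetric] pi_coeff_inverse mult_1_left)
    then show ?thesis using 2 by (simp add: mutate_u_def)
  next
    case 3
    then have "\<not> f \<subseteq> verts n" using f faces_inside by blast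
    then have "f \<in> faces n L" "f \<notin> faces n (Lam \<beta> \<alpha>)" "f \<notin> Dset n \<beta> \<alpha>" "f \<notin> Dset n \<alpha> \<beta>"
      using f faces_outside by (simp_all add: faces_Lam in_Dset)
    then show ?thesis using 3 by (simp add: mutate_u_def u_coeff')
  qed
qed

section \<open>The exchange relations of the two mutations\<close>

lemma b'_sig:
  assumes "f \<in> Dset n \<alpha> \<beta>" "g \<in> common"
  shows "b' (sig n f) g = - b f (sig n g)" "b' (sig n f) (sig n g) = - b f g"
  using exchange_matrix_sig[of f g] exchange_matrix_sig[of f "sig n g"] assms
    sig_common[OF assms(2)] sig_sig_common[OF assms(2)] by (simp_all add: in_Dset common_def)

lemma sum_common_sig: "(\<Sum>g\<in>common. F (sig n g)) = (\<Sum>g\<in>common. F g)"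
  by (rule sum.reindex_bij_witness[of _ "sig n" "sig n"]) (simp_all add: sig_common sig_sig_common)

text \<open>The sign of \<open>b'\<close> turns \<epsilon> into its negative, and reindexing by
  \<open>sig n\<close> interchanges the two arguments of the least common multiple, which is
  symmetric.\<close>

lemma lcm_part_swap:
  assumes f: "f \<in> Dset n \<alpha> \<beta>"
  shows "lcm_part n \<beta> \<alpha> b' \<epsilon> (sig n f) = lcm_part n \<alpha> \<beta> b (- \<epsilon>) f"
proof -
  have "(\<Sum>g\<in>common. replicate_mset (nat (\<epsilon> * b' (sig n f) g)) g) =
      (\<Sum>g\<in>common. replicate_mset (nat (- \<epsilon> * b f (sig n g))) (sig n (sig n g)))"
    by (intro sum.cong refl) (simp add: b'_sig[OF f] sig_sig_common)
  also have "\<dots> = (\<Sum>g\<in>common. replicate_mset (nat (- \<epsilon> * b f g)) (sig n g))"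
    by (rule sum_common_sig)
  finally have 1: "(\<Sum>g\<in>common. replicate_mset (nat (\<epsilon> * b' (sig n f) g)) g) =
    (\<Sum>g\<in>common. replicate_mset (nat (- \<epsilon> * b f g)) (sig n g))" .
  have "(\<Sum>g\<in>common. replicate_mset (nat (\<epsilon> * b' (sig n f) g)) (sig n g)) =
      (\<Sum>g\<in>common. replicate_mset (nat (- \<epsilon> * b f (sig n g))) (sig n g))"
    by (intro sum.cong refl) (simp add: b'_sig[OF f])
  also have "\<dots> = (\<Sum>g\<in>common. replicate_mset (nat (- \<epsilon> * b f g)) g)"
    by (rule sum_common_sig)
  finally have 2: "(\<Sum>g\<in>common. replicate_mset (nat (\<epsilon> * b' (sig n f) g)) (sig n g)) =
    (\<Sum>g\<in>common. replicate_mset (nat (- \<epsilon> * b f g)) g)" .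
  show ?thesis
    unfolding lcm_part_def common_eq 1 2 by (rule subset_mset.sup_commute)
qed

text \<open>The exponents \<open>b f g\<close> and \<open>- b f (sig n g)\<close> of the two denominators agree because both
  are positive entries of a matrix with entries in \<open>{-1, 0, 1}\<close>.\<close>

lemma denominator_swap:
  assumes f: "f \<in> Dset n \<alpha> \<beta>"
  shows "denominator n \<beta> \<alpha> b' (sig n f) = denominator n \<alpha> \<beta> b f"
  unfolding denominator_def common_eq
proof (rule sum.cong)
  show "{g \<in> common. b' (sig n f) g > 0 \<and> b' (sig n f) (sig n g) < 0} =
      {g \<in> common. b f g > 0 \<and> b f (sig n g) < 0}"
    using b'_sig[OF f] by auto
  fix g assume g: "g \<in> {g \<in> common. b f g > 0 \<and> b f (sig n g) < 0}"
  then have "b f g = 1" "b f (sig n g) = -1"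
    using abs_exchange_matrix_le[of f g] abs_exchange_matrix_le[of f "sig n g"] by auto
  then have "b' (sig n f) g = b f g" using b'_sig[OF f] g by simp
  then show "replicate_mset (nat (b' (sig n f) g)) g + replicate_mset (nat (b' (sig n f) g)) (sig n g) =
      replicate_mset (nat (b f g)) g + replicate_mset (nat (b f g)) (sig n g)" by simp
qed

text \<open>No changed variable occurs in an exchange monomial. Hence these monomials have the same
  values at both clusters and lie in the coefficient ring over which the changed variables are
  inverted.\<close>

lemma set_mset_lcm_part: "set_mset (lcm_part n \<alpha> \<beta> c \<epsilon> f) \<subseteq> common"
  and set_mset_denominator: "set_mset (denominator n \<alpha> \<beta> c f) \<subseteq> common"
  unfolding lcm_part_def denominator_def common_eq
  using finite_common by (auto simp: set_mset_sum sig_common split: if_splits)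

lemma cluster'_common_index:
  assumes "g \<in> faces n K - Dset n \<alpha> \<beta>"
  shows "cluster \<Sigma>' g = cluster \<Sigma> g"
  using assms unfolding faces_minus_Dset
  by (simp add: seed'_def seed_mutation_def mutate_cluster_def bm_eq)

lemma monomial_value':
  assumes "set_mset m \<subseteq> common"
  shows "monomial_value (cluster \<Sigma>') m = monomial_value (cluster \<Sigma>) m"
  using assms common_subset cluster'_common_index by (intro monomial_value_cong) blast

lemma exch_monomial_swap:
  assumes f: "f \<in> Dset n \<alpha> \<beta>"
  shows "exch_monomial \<iota> n \<beta> \<alpha> \<Sigma>' 1 (sig n f) = exch_monomial \<iota> n \<alpha> \<beta> \<Sigma> (-1) f"
    "exch_monomial \<iota> n \<beta> \<alpha> \<Sigma>' (-1) (sig n f) = exch_monomial \<iota> n \<alpha> \<beta> \<Sigma> 1 f"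
  unfolding exch_monomial_def exmat exmat' lcm_part_swap[OF f] denominator_swap[OF f]
  by (simp_all add: monomial_value' set_mset_lcm_part set_mset_denominator coefficients_Dset[OF f])

text \<open>With \<open>exch_den\<close> the numerator and denominator of P_f. They are kept apart
  because each is a polynomial in shared variables, while their quotient in general is not.\<close>

definition exch_sum :: "nat set \<Rightarrow> 'k" where
  "exch_sum f = \<iota> (pplus \<Sigma> f) * monomial_value (cluster \<Sigma>) (lcm_part n \<alpha> \<beta> b 1 f)
    + \<iota> (pminus \<Sigma> f) * monomial_value (cluster \<Sigma>) (lcm_part n \<alpha> \<beta> b (-1) f)"

definition exch_den :: "nat set \<Rightarrow> 'k" where
  "exch_den f = monomial_value (cluster \<Sigma>) (denominator n \<alpha> \<beta> b f)"

lemma exch_monomials: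
  "exch_monomial \<iota> n \<alpha> \<beta> \<Sigma> 1 f + exch_monomial \<iota> n \<alpha> \<beta> \<Sigma> (-1) f = exch_sum f / exch_den f"
  by (simp add: exch_monomial_def exch_sum_def exch_den_def exmat add_divide_distrib)

lemma cluster'_Dset:
  assumes "g \<in> Dset n \<beta> \<alpha>"
  shows "cluster \<Sigma>' g = exch_sum (sig n g) / exch_den (sig n g) / cluster \<Sigma> (sig n g)"
  using assms swap.Dset_subset unfolding exch_monomials[symmetric]
  by (auto simp: seed'_def seed_mutation_def mutate_cluster_def bm_eq)

section \<open>Independence of the new cluster and the inverse mutation\<close>

abbreviation "J \<equiv> faces n K - Dset n \<alpha> \<beta>"

lemma ZP: "subring (ZP \<iota>)"
  by (rule subring_ZP[OF embedding])

lemma cluster_nonzero: "f \<in> faces n K \<Longrightarrow> cluster \<Sigma> f \<noteq> 0"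
  using algebraically_independent_nonzero[OF in_seedsD(2)[OF seed]] ZP by (simp add: subring_def)

lemma exch_den: "exch_den f \<in> polynomial_values (ZP \<iota>) J (cluster \<Sigma>)" "exch_den f \<noteq> 0"
proof -
  have "set_mset (denominator n \<alpha> \<beta> b f) \<subseteq> J"
    using set_mset_denominator common_subset by (rule order_trans)
  then show "exch_den f \<in> polynomial_values (ZP \<iota>) J (cluster \<Sigma>)" "exch_den f \<noteq> 0"
    unfolding exch_den_def
    by (intro monomial_value_in_polynomial_values monomial_value_nonzero cluster_nonzero ZP; blast)+
qed

lemma exch_sum: "exch_sum f \<in> polynomial_values (ZP \<iota>) J (cluster \<Sigma>)" "exch_sum f \<noteq> 0"
proof -
  have sub: "set_mset (lcm_part n \<alpha> \<beta> b \<epsilon> f) \<subseteq> J" for \<epsilon>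
    using set_mset_lcm_part common_subset by (rule order_trans)
  then show "exch_sum f \<in> polynomial_values (ZP \<iota>) J (cluster \<Sigma>)"
    unfolding exch_sum_def
    by (intro combinations_add combinations_term ZP group_ring_embedding_in_ZP) simp_all
  have "set_mset (lcm_part n \<alpha> \<beta> b \<epsilon> f) \<subseteq> faces n K" for \<epsilon> using sub by blast
  then show "exch_sum f \<noteq> 0"
    unfolding exch_sum_def by (intro binomial_nonzero[OF embedding in_seedsD(2)[OF seed]])
qed

lemma algebraically_independent': "algebraically_independent (ZP \<iota>) (faces n L) (cluster \<Sigma>')"
proof -
  let ?x = "cluster \<Sigma>" and ?R = "ZP \<iota>"
  let ?S = "polynomial_values ?R J ?x"
  have S: "subring ?S" by (rule subring_polynomial_values[OF ZP])
  have un: "faces n K = J \<union> Dset n \<alpha> \<beta>" "faces n L = J \<union> Dset n \<beta> \<alpha>"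
    using Dset_subset swap.Dset_subset faces_minus_Dset by auto
  have ind: "algebraically_independent ?R (J \<union> Dset n \<alpha> \<beta>) ?x"
    using in_seedsD(2)[OF seed] un(1) by simp
  have "algebraically_independent ?S (Dset n \<alpha> \<beta>) ?x"
    by (rule algebraically_independent_tower[OF ind]) blast
  then have "algebraically_independent ?S (Dset n \<alpha> \<beta>) (\<lambda>f. exch_sum f / exch_den f / ?x f)"
    by (rule algebraically_independent_invert[OF S]) (simp_all add: exch_sum exch_den)
  then have "algebraically_independent ?S (Dset n \<beta> \<alpha>) ((\<lambda>f. exch_sum f / exch_den f / ?x f) \<circ> sig n)"
  proof (rule algebraically_independent_reindex)
    show "inj_on (sig n) (Dset n \<beta> \<alpha>)" using sig_sig_Dset(2) by (rule inj_on_inverseI)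
    show "sig n ` Dset n \<beta> \<alpha> \<subseteq> Dset n \<alpha> \<beta>" using swap.sig_Dset by auto
  qed
  \<comment> \<open>The shared variables have equal values in both clusters, so the coefficient ring
    can be expressed by the new cluster before the tower is reassembled.\<close>
  moreover have "?S = polynomial_values ?R J (cluster \<Sigma>')"
    using cluster'_common_index by (intro polynomial_values_cong) simp
  ultimately have "algebraically_independent (polynomial_values ?R J (cluster \<Sigma>')) (Dset n \<beta> \<alpha>) (cluster \<Sigma>')"
    using algebraically_independent_cong[of "Dset n \<beta> \<alpha>" "cluster \<Sigma>'"
        "(\<lambda>f. exch_sum f / exch_den f / ?x f) \<circ> sig n"] cluster'_Dset by simp
  moreover have "algebraically_independent ?R J ?x"
    using ind Un_upper1 by (rule algebraically_independent_mono)
  then have "algebraically_independent ?R J (cluster \<Sigma>')"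
    using algebraically_independent_cong[of J "cluster \<Sigma>'" ?x] cluster'_common_index by simp
  ultimately show ?thesis
    unfolding un(2) by (intro algebraically_independent_tower_conv)
qed

lemma seed': "\<Sigma>' \<in> seeds \<iota> n L ori'"
proof -
  have "cluster \<Sigma>' \<in> extensional (faces n L)" "pplus \<Sigma>' \<in> extensional (faces n L)"
    "pminus \<Sigma>' \<in> extensional (faces n L)"
    by (simp_all add: seed'_def seed_mutation_def mutate_cluster_def bm_eq)
  moreover have "pplus \<Sigma>' f + pminus \<Sigma>' f = 1" if "f \<in> faces n L" for f
    using that by (simp add: coefficients' normalized_pair_sum)
  ultimately show ?thesis
    using algebraically_independent' exmat' by (simp add: seeds_def)
qed

lemma involution: "seed_mutation \<iota> n L \<beta> \<alpha> \<Sigma>' = \<Sigma>" (is "?\<Sigma> = _")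
proof (rule seed.equality)
  show "cluster ?\<Sigma> = cluster \<Sigma>"
  proof
    fix g
    consider "g \<notin> faces n K" | "g \<in> Dset n \<alpha> \<beta>" | "g \<in> J" by blast
    then show "cluster ?\<Sigma> g = cluster \<Sigma> g"
    proof cases
      case 1
      then show ?thesis
        using in_seedsD(1)[OF seed]
        by (simp add: seed_mutation_def mutate_cluster_def swap.bm_eq extensional_def)
    next
      case 2
      then have g: "g \<in> faces n K" using Dset_subset by blast
      have "exch_monomial \<iota> n \<beta> \<alpha> \<Sigma>' 1 (sig n g) + exch_monomial \<iota> n \<beta> \<alpha> \<Sigma>' (-1) (sig n g) =
          exch_sum g / exch_den g"
        unfolding exch_monomial_swap[OF 2] exch_monomials[symmetric] by (rule add.commute)
      moreover have "cluster \<Sigma>' (sig n g) = exch_sum g / exch_den g / cluster \<Sigma> g"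
        using cluster'_Dset[OF sig_Dset[OF 2]] by (simp add: sig_sig_Dset(1)[OF 2])
      ultimately have "cluster ?\<Sigma> g = (exch_sum g / exch_den g) / (exch_sum g / exch_den g / cluster \<Sigma> g)"
        using 2 g by (simp add: seed_mutation_def mutate_cluster_def swap.bm_eq)
      also have "\<dots> = cluster \<Sigma> g"
        using exch_sum(2) exch_den(2) cluster_nonzero[OF g] by simp
      finally show ?thesis .
    next
      case 3
      then show ?thesis
        using cluster'_common_index[OF 3]
        by (simp add: seed_mutation_def mutate_cluster_def swap.bm_eq)
    qed
  qed
  show "pplus ?\<Sigma> = pplus \<Sigma>"
  proof
    fix f show "pplus ?\<Sigma> f = pplus \<Sigma> f"
      using in_seedsD(3)[OF seed]
      by (cases "f \<in> faces n K")
        (simp_all add: seed_mutation_def swap.bm_eq mutate_u_involution normalized_u_coeff extensional_def)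
  qed
  show "pminus ?\<Sigma> = pminus \<Sigma>"
  proof
    fix f show "pminus ?\<Sigma> f = pminus \<Sigma> f"
      using in_seedsD(4)[OF seed]
      by (cases "f \<in> faces n K")
        (simp_all add: seed_mutation_def swap.bm_eq mutate_u_involution normalized_u_coeff extensional_def)
  qed
  show "exmat ?\<Sigma> = exmat \<Sigma>"
    by (simp add: seed_mutation_def exmat' exmat swap.mutate_exchange_matrix)
qed simp

end

context bistellar_flip
begin

lemma seed_mutation_in_seeds:
  fixes \<iota> :: "'p::semifield \<Rightarrow> 'k::field"
  assumes "group_ring_embedding \<iota>" "\<Sigma> \<in> seeds \<iota> n K ori"
  shows "seed_mutation \<iota> n K \<alpha> \<beta> \<Sigma> \<in> seeds \<iota> n L ori'"
    "seed_mutation \<iota> n L \<beta> \<alpha> (seed_mutation \<iota> n K \<alpha> \<beta> \<Sigma>) = \<Sigma>"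
proof -
  interpret mutated_seed n K L \<alpha> \<beta> ori ori' \<iota> \<Sigma> "seed_mutation \<iota> n K \<alpha> \<beta> \<Sigma>"
    using assms by unfold_locales auto
  show "seed_mutation \<iota> n K \<alpha> \<beta> \<Sigma> \<in> seeds \<iota> n L ori'" by (rule seed')
  show "seed_mutation \<iota> n L \<beta> \<alpha> (seed_mutation \<iota> n K \<alpha> \<beta> \<Sigma>) = \<Sigma>" by (rule involution)
qed

end

subsection \<open>The normalized labelling\<close>

lemma link_eq_bdryD:
  assumes "link K \<alpha> = bdry \<beta>" "\<alpha> \<subseteq> F" "F \<in> K"
  shows "F \<subseteq> \<alpha> \<union> \<beta>" "\<not> \<beta> \<subseteq> F - \<alpha>"
proof -
  have "F - \<alpha> \<in> link K \<alpha>" using assms(2,3) by (auto simp: link_def Un_absorb2)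
  then have "F - \<alpha> \<subset> \<beta>" unfolding assms(1) by (simp add: bdry_def)
  then show "F \<subseteq> \<alpha> \<union> \<beta>" "\<not> \<beta> \<subseteq> F - \<alpha>" by auto
qed

lemma bistellar_complex:
  assumes K: "simplicial_complex K" and pair: "\<alpha> \<in> K" "link K \<alpha> = bdry \<beta>" "\<beta> \<notin> K"
    and V: "\<alpha> \<inter> \<beta> = {}"
  shows "K \<inter> Pow (\<alpha> \<union> \<beta>) = Lam \<alpha> \<beta>"
    "bm K \<alpha> \<beta> \<inter> Pow (\<alpha> \<union> \<beta>) = Lam \<beta> \<alpha>"
    "K - Pow (\<alpha> \<union> \<beta>) = bm K \<alpha> \<beta> - Pow (\<alpha> \<union> \<beta>)"
    "s \<in> bm K \<alpha> \<beta> \<Longrightarrow> t \<subseteq> s \<Longrightarrow> t \<in> bm K \<alpha> \<beta>"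
proof -
  have down: "t \<in> K" if "s \<in> K" "t \<subseteq> s" for s t
    using K that unfolding simplicial_complex_def by blast
  have Lam: "f \<in> Lam \<alpha> \<beta> \<longleftrightarrow> f \<subseteq> \<alpha> \<union> \<beta> \<and> \<not> \<beta> \<subseteq> f"
    "f \<in> Lam \<beta> \<alpha> \<longleftrightarrow> f \<subseteq> \<alpha> \<union> \<beta> \<and> \<not> \<alpha> \<subseteq> f" for f
    using Lam_iff[of \<alpha> \<beta> f] Lam_iff[of \<beta> \<alpha> f] V by (simp_all add: Un_commute Int_commute)
  show in_K: "K \<inter> Pow (\<alpha> \<union> \<beta>) = Lam \<alpha> \<beta>"
  proof
    show "K \<inter> Pow (\<alpha> \<union> \<beta>) \<subseteq> Lam \<alpha> \<beta>"
      using down pair(3) by (auto simp: Lam)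
    show "Lam \<alpha> \<beta> \<subseteq> K \<inter> Pow (\<alpha> \<union> \<beta>)"
    proof
      fix s assume s: "s \<in> Lam \<alpha> \<beta>"
      then have sub: "s \<subseteq> \<alpha> \<union> \<beta>" by (simp add: Lam)
      \<comment> \<open>By the link condition the proper face \<open>s \<inter> \<beta>\<close> of
        \<open>\<beta>\<close> spans a simplex of \<open>K\<close> with \<open>\<alpha>\<close>, and
        \<open>s\<close> is a face of that simplex.\<close>
      have "s \<inter> \<beta> \<in> bdry \<beta>" using s by (auto simp: Lam bdry_def)
      then have "(s \<inter> \<beta>) \<union> \<alpha> \<in> K" unfolding pair(2)[symmetric] by (simp add: link_def)
      moreover have "s \<subseteq> (s \<inter> \<beta>) \<union> \<alpha>" using sub by blast
      ultimately have "s \<in> K" by (rule down)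
      then show "s \<in> K \<inter> Pow (\<alpha> \<union> \<beta>)" using sub by simp
    qed
  qed
  show "bm K \<alpha> \<beta> \<inter> Pow (\<alpha> \<union> \<beta>) = Lam \<beta> \<alpha>"
    unfolding bm_def in_K[symmetric] using Lam(2) by blast
  show "K - Pow (\<alpha> \<union> \<beta>) = bm K \<alpha> \<beta> - Pow (\<alpha> \<union> \<beta>)"
    unfolding bm_def using Lam by blast
  assume s: "s \<in> bm K \<alpha> \<beta>" and t: "t \<subseteq> s"
  show "t \<in> bm K \<alpha> \<beta>"
  proof (cases "s \<in> Lam \<beta> \<alpha>")
    case True
    then have "t \<in> Lam \<beta> \<alpha>" using t unfolding Lam by blast
    then show ?thesis by (simp add: bm_def)
  next
    case False
    then have s: "s \<in> K" "s \<notin> Lam \<alpha> \<beta>" using s by (auto simp: bm_def)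
    \<comment> \<open>A simplex containing \<open>\<alpha>\<close> stays within
      \<open>\<alpha> \<union> \<beta>\<close> by the link condition, so \<open>s\<close> does not
      contain \<open>\<alpha>\<close>, nor does its face \<open>t\<close>. If \<open>t\<close> was
      removed by the move, it is therefore put back as a member of
      \<open>Lam \<beta> \<alpha>\<close>.\<close>
    then have "\<not> s \<subseteq> \<alpha> \<union> \<beta>" using in_K by blast
    then have "\<not> \<alpha> \<subseteq> s" using link_eq_bdryD(1)[OF pair(2) _ s(1)] by blast
    then have "\<not> \<alpha> \<subseteq> t" using t by blast
    moreover have "t \<in> K" using s(1) t by (rule down)
    ultimately show ?thesis unfolding bm_def Un_iff Diff_iff Lam by blast
  qed
qed

lemma bistellar_pair_swap:
  assumes "simplicial_complex K" "bistellar_pair h K \<alpha> \<beta>" "\<alpha> \<inter> \<beta> = {}"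
  shows "bistellar_pair h (bm K \<alpha> \<beta>) \<beta> \<alpha>"
proof -
  have pair: "\<alpha> \<in> K" "link K \<alpha> = bdry \<beta>" "\<beta> \<notin> K" "finite \<alpha>" "card \<alpha> = h + 1" "finite \<beta>" "card \<beta> = h + 1"
    using assms(2) by (auto simp: bistellar_pair_def)
  note c = bistellar_complex[OF assms(1) pair(1-3) assms(3)]
  have Lam: "f \<in> Lam \<beta> \<alpha> \<longleftrightarrow> f \<subseteq> \<alpha> \<union> \<beta> \<and> \<not> \<alpha> \<subseteq> f" for f
    using Lam_iff[of \<beta> \<alpha> f] assms(3) by (simp add: Un_commute Int_commute)
  have ne: "\<alpha> \<noteq> {}" using pair(5) by auto
  have in_L: "f \<in> bm K \<alpha> \<beta> \<longleftrightarrow> \<not> \<alpha> \<subseteq> f" if "f \<subseteq> \<alpha> \<union> \<beta>" for f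
    using c(2) Lam that by blast
  have "\<not> \<alpha> \<subseteq> \<beta>" using ne assms(3) by blast
  then have "\<beta> \<in> bm K \<alpha> \<beta>" "\<alpha> \<notin> bm K \<alpha> \<beta>" by (simp_all add: in_L)
  moreover have "link (bm K \<alpha> \<beta>) \<beta> = bdry \<alpha>"
  proof (rule set_eqI)
    fix t show "t \<in> link (bm K \<alpha> \<beta>) \<beta> \<longleftrightarrow> t \<in> bdry \<alpha>"
    proof (cases "t \<subseteq> \<alpha>")
      case True
      then have "t \<inter> \<beta> = {}" "t \<union> \<beta> \<subseteq> \<alpha> \<union> \<beta>" "\<alpha> \<subseteq> t \<union> \<beta> \<longleftrightarrow> t = \<alpha>" using assms(3) by auto
      then show ?thesis using True by (simp add: link_def bdry_def in_L psubset_eq)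
    next
      case False
      \<comment> \<open>Such a simplex would leave \<open>\<alpha> \<union> \<beta>\<close>, where
        the move changes nothing; it would lie in \<open>K\<close> and force \<open>\<beta>\<close>
        into \<open>K\<close>.\<close>
      have "t \<union> \<beta> \<notin> bm K \<alpha> \<beta>" if "t \<inter> \<beta> = {}"
      proof
        assume L: "t \<union> \<beta> \<in> bm K \<alpha> \<beta>"
        have "\<not> t \<union> \<beta> \<subseteq> \<alpha> \<union> \<beta>" using False that by blast
        then have "t \<union> \<beta> \<in> K" using c(3) L by blast
        then have "\<beta> \<in> K" using assms(1) unfolding simplicial_complex_def by (meson Un_upper2)
        then show False using pair(3) by contradiction
      qed
      then show ?thesis using False by (auto simp: link_def bdry_def)
    qed
  qed
  ultimately show ?thesis using pair by (simp add: bistellar_pair_def)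
qed

section \<open>Orientations in the normalized labelling\<close>

lemma card_eq_Suc_subset_verts:
  assumes "F \<subseteq> verts n" "card F = n + 1"
  obtains i where "i \<in> verts n" "F = verts n - {i}"
proof -
  have "finite F" using assms(1) finite_verts by (rule finite_subset)
  then have "card (verts n - F) = 1" using assms by (simp add: card_Diff_subset)
  then obtain i where i: "verts n - F = {i}" by (auto simp: card_1_singleton_iff)
  have "F = verts n - (verts n - F)" using assms(1) by blast
  then show ?thesis using that[of i] i by auto
qed

lemma sorted_list_of_set_verts_remove:
  assumes "1 \<le> i" "i < n + 2"
  shows "sorted_list_of_set (verts n - {i}) = [1..<i] @ [i + 1..<n + 2] @ [n + 2]"
    "sorted_list_of_set (verts n - {n + 2}) = [1..<i] @ i # [i + 1..<n + 2]"
    "sorted_list_of_set (verts n - {i, n + 2}) = [1..<i] @ [i + 1..<n + 2]"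
  using assms
  by (intro sorted_distinct_set_unique; auto simp: sorted_append verts_def)+

text \<open>The two \<open>n\<close>-simplices containing \<open>verts n - {i, n + 2}\<close> induce opposite orientations
  on it.\<close>

lemma ori_eq_sign:
  assumes K: "oriented_triangulated_manifold n K ori" and n: "even n"
    and link: "link K \<alpha> = bdry \<beta>" and V: "\<alpha> \<union> \<beta> = verts n" "\<alpha> \<inter> \<beta> = {}"
    and \<beta>: "i \<in> \<beta>" "n + 2 \<in> \<beta>"
    and in_K: "verts n - {i} \<in> K" "verts n - {n + 2} \<in> K" and pos: "ori (verts n - {n + 2}) = 1"
  shows "ori (verts n - {i}) = (-1) ^ i"
proof (cases "i = n + 2")
  case True
  then show ?thesis using pos n by simp
next
  case False
  have "i \<in> verts n" using \<beta>(1) V(1) by blast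
  then have i: "1 \<le> i" "i < n + 2" using False by (auto simp: verts_def)
  let ?f = "verts n - {i, n + 2}"
  let ?e = "sorted_list_of_set ?f"
  let ?F = "verts n - {i}" and ?G = "verts n - {n + 2}"
  let ?t = "\<lambda>F. ori F * iter_boundary 1 (sorted_list_of_set F) ?e"
  have FG: "?F \<noteq> ?G" using i by (auto simp: verts_def set_eq_iff)
  have mem: "i \<in> verts n" "n + 2 \<in> verts n" using i by (auto simp: verts_def)
  have finK: "finite K" and cyc: "(\<Sum>F\<in>simplices n K. ?t F) = 0"
    using K unfolding oriented_triangulated_manifold_def by blast+
  have "(\<Sum>F\<in>simplices n K. ?t F) = (\<Sum>F\<in>{?F, ?G}. ?t F)"
  proof (rule sum.mono_neutral_right)
    show "finite (simplices n K)" using finK by (simp add: simplices_def)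
    show "{?F, ?G} \<subseteq> simplices n K" using in_K mem by (simp add: simplices_def)
    show "\<forall>F\<in>simplices n K - {?F, ?G}. ?t F = 0"
    proof
      fix F assume F: "F \<in> simplices n K - {?F, ?G}"
      then have "finite F" "card F = n + 1" "F \<in> K" by (auto simp: simplices_def)
      have "\<not> ?f \<subseteq> F"
      proof
        assume f: "?f \<subseteq> F"
        \<comment> \<open>Both omitted vertices belong to \<open>\<beta>\<close>. So
          \<open>F\<close> contains \<open>\<alpha>\<close>, and the link condition confines it to
          \<open>verts n\<close>, leaving only \<open>?F\<close> and \<open>?G\<close>.\<close>
        have "\<alpha> \<subseteq> ?f" using V \<beta> by blast
        then have "F \<subseteq> verts n"
          using link_eq_bdryD(1)[OF link _ \<open>F \<in> K\<close>] f V(1) by blast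
        then obtain j where j: "j \<in> verts n" "F = verts n - {j}"
          using \<open>card F = n + 1\<close> by (rule card_eq_Suc_subset_verts)
        then have "j = i \<or> j = n + 2" using f by blast
        then show False using F j(2) by blast
      qed
      then have "iter_boundary 1 (sorted_list_of_set F) ?e = 0"
        using \<open>finite F\<close> by (intro iter_boundary_zero) simp
      then show "?t F = 0" by simp
    qed
  qed
  then have 0: "?t ?F + ?t ?G = 0" using cyc FG by simp
  \<comment> \<open>In \<open>?F\<close> the deleted vertex \<open>n + 2\<close> is last, at the
    even index \<open>n\<close>. In \<open>?G\<close>, treated next, the vertex \<open>i\<close>
    stands at index \<open>i - 1\<close> since vertices are counted from 1.\<close>
  have F: "iter_boundary 1 (sorted_list_of_set ?F) ?e = 1"
  proof -
    let ?xs = "[1..<i] @ [i + 1..<n + 2]"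
    have "iter_boundary 1 (?xs @ (n + 2) # []) (?xs @ []) = (-1) ^ length ?xs"
      using i by (intro iter_boundary_remove1) auto
    moreover have "length ?xs = n"
      using i unfolding length_append length_upt by linarith
    ultimately show ?thesis
      unfolding sorted_list_of_set_verts_remove[OF i] using n by simp
  qed
  have G: "iter_boundary 1 (sorted_list_of_set ?G) ?e = (-1) ^ (i - 1)"
  proof -
    have "iter_boundary 1 ([1..<i] @ i # [i + 1..<n + 2]) ([1..<i] @ [i + 1..<n + 2]) = (-1) ^ length [1..<i]"
      by (rule iter_boundary_remove1) auto
    then show ?thesis unfolding sorted_list_of_set_verts_remove[OF i] by simp
  qed
  have "ori ?F = - ((-1) ^ (i - 1))" using 0 unfolding F G pos by simp
  also have "\<dots> = (-1) ^ i" using i(1) by (cases i) auto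
  finally show ?thesis .
qed

theorem proposition5p9:
  fixes h n :: nat
    and K L :: "nat set set"
    and ori oriL :: "nat set \<Rightarrow> int"
    and \<alpha> \<beta> :: "nat set"
    and \<iota> :: "'p::semifield \<Rightarrow> 'k::field"
  assumes "n = 2 * h" and "n > 1"
    and "oriented_triangulated_manifold n K ori"
    and "bistellar_pair h K \<alpha> \<beta>"
    and "\<alpha> = {1..h + 1}" and "\<beta> = {h + 2..n + 2}" and "ori {1..n + 1} = 1"
    and "L = bm K \<alpha> \<beta>" and "oriL = bm_orientation h n K ori"
    and "group_ring_embedding \<iota>"
  shows "bistellar_pair h L \<beta> \<alpha> \<and> bm L \<beta> \<alpha> = K
    \<and> bij_betw (phi n \<alpha> \<beta>) (faces n K) (faces n L)
    \<and> bij_betw (phi n \<beta> \<alpha>) (faces n L) (faces n K)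
    \<and> (\<forall>f \<in> faces n K. phi n \<beta> \<alpha> (phi n \<alpha> \<beta> f) = f)
    \<and> (\<forall>f \<in> faces n L. phi n \<alpha> \<beta> (phi n \<beta> \<alpha> f) = f)
    \<and> seed_mutation \<iota> n K \<alpha> \<beta> \<in> seeds \<iota> n K ori \<rightarrow> seeds \<iota> n L oriL
    \<and> seed_mutation \<iota> n L \<beta> \<alpha> \<in> seeds \<iota> n L oriL \<rightarrow> seeds \<iota> n K ori
    \<and> (\<forall>\<Sigma> \<in> seeds \<iota> n K ori. seed_mutation \<iota> n L \<beta> \<alpha> (seed_mutation \<iota> n K \<alpha> \<beta> \<Sigma>) = \<Sigma>)
    \<and> (\<forall>\<Sigma> \<in> seeds \<iota> n L oriL. seed_mutation \<iota> n K \<alpha> \<beta> (seed_mutation \<iota> n L \<beta> \<alpha> \<Sigma>) = \<Sigma>)"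
proof -
  note manifold = assms(3) and \<alpha> = assms(5) and \<beta> = assms(6)
  have h: "0 < h" "even n" "0 < n" using assms(1,2) by auto
  have K: "simplicial_complex K" "finite K"
    and ori1: "\<And>F. F \<in> simplices n K \<Longrightarrow> ori F = 1 \<or> ori F = -1"
    using manifold unfolding oriented_triangulated_manifold_def by blast+
  have pair: "\<alpha> \<in> K" "link K \<alpha> = bdry \<beta>" "\<beta> \<notin> K"
    using assms(4) by (auto simp: bistellar_pair_def)
  have V: "\<alpha> \<union> \<beta> = verts n" "\<alpha> \<inter> \<beta> = {}"
    unfolding \<alpha> \<beta> verts_def using assms(1) by auto
  have sig_mem: "sig n f = {j. j \<in> verts n \<and> n + 3 - j \<in> f}" if "f \<subseteq> verts n" for f
  proof (rule set_eqI)
    fix j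
    show "j \<in> sig n f \<longleftrightarrow> j \<in> {j. j \<in> verts n \<and> n + 3 - j \<in> f}"
    proof
      assume "j \<in> sig n f"
      then obtain k where "k \<in> f" "j = n + 3 - k" by (auto simp: sig_def)
      moreover from this have "1 \<le> k" "k \<le> n + 2" using that by (auto simp: verts_def)
      ultimately show "j \<in> {j. j \<in> verts n \<and> n + 3 - j \<in> f}" by (auto simp: verts_def)
    next
      assume j: "j \<in> {j. j \<in> verts n \<and> n + 3 - j \<in> f}"
      then have "j = n + 3 - (n + 3 - j)" by (auto simp: verts_def)
      then show "j \<in> sig n f" unfolding sig_def using j by blast
    qed
  qed
  have sig: "sig n \<alpha> = \<beta>" "sig n \<beta> = \<alpha>"
  proof -
    have "sig n \<alpha> = {j. j \<in> verts n \<and> n + 3 - j \<in> \<alpha>}" by (rule sig_mem) (use V in blast)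
    also have "\<dots> = \<beta>" unfolding \<alpha> \<beta> verts_def using assms(1) by auto
    finally show "sig n \<alpha> = \<beta>" .
    then show "sig n \<beta> = \<alpha>" using sig_sig[of \<alpha> n] V(1) by blast
  qed
  note c = bistellar_complex[OF K(1) pair V(2), folded assms(8), unfolded V(1)]
  have Lam: "f \<in> Lam \<alpha> \<beta> \<longleftrightarrow> f \<subseteq> verts n \<and> \<not> \<beta> \<subseteq> f" for f
    using Lam_iff[OF V(2), of f] V(1) by simp
  have oriL_old: "oriL F = ori F" if "F \<in> K" for F
    using that by (simp add: assms(9) bm_orientation_def)
  have flip: "bistellar_flip n K L \<alpha> \<beta> ori oriL"
  proof
    show "t \<in> K" if "s \<in> K" "t \<subseteq> s" for s t
      using K(1) that unfolding simplicial_complex_def by blast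
    show "finite L"
    proof (rule finite_subset)
      show "L \<subseteq> K \<union> Pow (verts n)" using c(3) by blast
    qed (use K(2) in simp)
    show "\<bar>ori F\<bar> \<le> 1" if "F \<in> simplices n K" for F
      using ori1[OF that] by auto
    \<comment> \<open>Whatever index the description in \<open>bm_orientation\<close> selects, the
      sign of a new simplex is a power of -1.\<close>
    show "\<bar>oriL F\<bar> \<le> 1" if "F \<in> simplices n L" for F
    proof (cases "F \<in> K")
      case True
      then have "F \<in> simplices n K" using that by (simp add: simplices_def)
      then show ?thesis using ori1[of F] oriL_old[OF True] by auto
    qed (simp add: assms(9) bm_orientation_def power_abs)
    show "oriL F = ori F" if "F \<in> K - Pow (verts n)" for F
      using that by (intro oriL_old) blast
    show "oriL (sig n F) = ori F" if F: "F \<in> simplices n (Lam \<alpha> \<beta>)" for F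
    proof -
      have "F \<subseteq> verts n" "card F = n + 1" "\<not> \<beta> \<subseteq> F" using F by (auto simp: simplices_def Lam)
      then obtain i where i: "i \<in> verts n" "F = verts n - {i}"
        by (meson card_eq_Suc_subset_verts)
      then have i\<beta>: "i \<in> \<beta>" using \<open>\<not> \<beta> \<subseteq> F\<close> V(1) by blast
      have in_K: "verts n - {j} \<in> K" if "j \<in> \<beta>" for j
        using c(1) Lam[of "verts n - {j}"] that by blast
      have last: "n + 2 \<in> \<beta>" using assms(1) by (simp add: \<beta>)
      have "verts n - {n + 2} = {1..n + 1}" by (auto simp: verts_def)
      then have ori_F: "ori F = (-1) ^ i"
        unfolding i(2) using assms(7)
        by (intro ori_eq_sign[OF manifold h(2) pair(2) V i\<beta> last in_K[OF i\<beta>] in_K[OF last]]) simp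
      have bounds: "h + 2 \<le> i" "i \<le> n + 2" using i\<beta> by (auto simp: \<beta>)
      have sF: "sig n F = verts n - {n + 3 - i}"
        unfolding i(2) sig_mem[OF Diff_subset] using bounds by (auto simp: verts_def)
      have "n + 3 - i \<in> \<alpha>" using bounds assms(1) by (auto simp: \<alpha>)
      then have "\<beta> \<subseteq> sig n F" unfolding sF using V by blast
      then have "sig n F \<notin> K" using K(1) pair(3) unfolding simplicial_complex_def by blast
      \<comment> \<open>The mirror image omits the vertex \<open>n + 3 - i\<close>, whereas
        \<open>bm_orientation\<close> counts the omitted vertex as \<open>k + 1\<close>. So
        \<open>k = n + 2 - i\<close>, which has the parity of \<open>i\<close> because
        \<open>n\<close> is even.\<close>
      moreover have "(THE k. k \<le> h \<and> sig n F = {1..n + 2} - {k + 1}) = n + 2 - i"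
      proof (rule the_equality)
        show "n + 2 - i \<le> h \<and> sig n F = {1..n + 2} - {n + 2 - i + 1}"
          unfolding sF verts_def using bounds assms(1) by (auto simp: Suc_diff_le)
        fix k assume k: "k \<le> h \<and> sig n F = {1..n + 2} - {k + 1}"
        have "k + 1 \<in> verts n" using k assms(1) by (simp add: verts_def)
        moreover have "k + 1 \<notin> sig n F" using k by simp
        ultimately have "k + 1 = n + 3 - i" unfolding sF by blast
        then show "k = n + 2 - i" by simp
      qed
      ultimately have "oriL (sig n F) = (-1) ^ (n + 2 - i)"
        by (simp add: assms(9) bm_orientation_def)
      also have "\<dots> = (-1) ^ i"
        using h(2) bounds by (simp add: minus_one_power_iff)
      finally show ?thesis using ori_F by simp
    qed
  qed (use h V sig K(2) c in auto)
  interpret bistellar_flip n K L \<alpha> \<beta> ori oriL by (rule flip)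
  interpret swap: bistellar_flip n L K \<beta> \<alpha> oriL ori by (rule flip_sym)
  have "bij_betw (phi n \<alpha> \<beta>) (faces n K) (faces n L)" "bij_betw (phi n \<beta> \<alpha>) (faces n L) (faces n K)"
    by (rule bij_betw_byWitness[of _ "phi n \<beta> \<alpha>"] bij_betw_byWitness[of _ "phi n \<alpha> \<beta>"],
        use phi_phi phi_in swap.phi_phi swap.phi_in in auto)+
  then show ?thesis
    using bistellar_pair_swap[OF K(1) assms(4) V(2)] swap.bm_eq phi_phi swap.phi_phi
      seed_mutation_in_seeds[OF assms(10)] swap.seed_mutation_in_seeds[OF assms(10)]
    unfolding assms(8)[symmetric] by auto
qed

end
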